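(* Let $(\lambda_n)_{n\ge0}$ be an increasing sequence of non-negative real numbers tending to infinity, let $(c_n)_{n\ge0}$ be complex numbers, and suppose $$\sum_{\lambda_n\le x}\lambda_n|c_n|=O(x)\quad(x\to\infty).$$ Let $\ell\in\mathbb{C}$. Then the following six statements are equivalent. The series $\sum_{n=0}^\infty c_n$ is: (a) $(\mathrm{L},\{\lambda_n\})$ summable to $\ell$; (b) $(\gamma,\{\lambda_n\},\kappa)$ summable to $\ell$ for some $\kappa\ge1$; (c) $(\gamma,\{\lambda_n\},\kappa)$ summable to $\ell$ for all $\kappa\ge1$; (d) $(\mathrm{R},\{\lambda_n\},\beta)$ summable to $\ell$ for some $\beta>0$; (e) $(\mathrm{R},\{\lambda_n\},\beta)$ summable to $\ell$ for all $\beta>0$; (f) $(\mathrm{A},\{\lambda_n\})$ summable to $\ell$.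
   Context: Riesz summability: $\sum c_n=\ell$ $(\mathrm{R},\{\lambda_n\},\beta)$ means $\lim_{x\to\infty}\sum_{\lambda_n\le x}c_n(1-\lambda_n/x)^\beta=\ell$. Abel-type summability: $\sum c_n=\ell$ $(\mathrm{A},\{\lambda_n\})$ means $\sum_n c_ne^{-\lambda_ny}$ converges for every $y>0$ and tends to $\ell$ as $y\to0^+$. Young functions: for $\kappa>0$, $\gamma_\kappa(x)=\frac{\kappa}{x}\int_0^x(1-t/x)^{\kappa-1}\cos t\,dt$ (with $\gamma_\kappa(0)=1$). $\sum c_n=\ell$ $(\gamma,\{\lambda_n\},\kappa)$ means $\sum_n c_n\gamma_\kappa(\lambda_nh)$ converges for all sufficiently small $h>0$ and tends to $\ell$ as $h\to0^+$. $\sum c_n=\ell$ $(\mathrm{L},\{\lambda_n\})$ means $\sum c_n=\ell$ $(\gamma,\{\lambda_n\},1)$ and additionally $\sum_{\lambda_n>0}c_n\frac{e^{i\lambda_nh}}{\lambda_nh}$ converges for all sufficiently small $|h|>0$. *)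

theory Defs
  imports "HOL-Analysis.Analysis" "HOL-Library.Landau_Symbols"
begin

definition riesz_summable ::
  "(nat \<Rightarrow> real) \<Rightarrow> real \<Rightarrow> (nat \<Rightarrow> complex) \<Rightarrow> complex \<Rightarrow> bool" where
  "riesz_summable lam \<beta> c l \<longleftrightarrow>
     ((\<lambda>x. \<Sum>n\<in>{n. lam n \<le> x}. c n * complex_of_real ((1 - lam n / x) powr \<beta>))
        \<longlongrightarrow> l) at_top"

definition abel_summable ::
  "(nat \<Rightarrow> real) \<Rightarrow> (nat \<Rightarrow> complex) \<Rightarrow> complex \<Rightarrow> bool" where
  "abel_summable lam c l \<longleftrightarrow>
     (\<forall>y>0. summable (\<lambda>n. c n * complex_of_real (exp (- lam n * y)))) \<and>
     ((\<lambda>y. \<Sum>n. c n * complex_of_real (exp (- lam n * y))) \<longlongrightarrow> l) (at_right 0)"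

definition young_fun :: "real \<Rightarrow> real \<Rightarrow> real" where
  "young_fun \<kappa> x = (if x = 0 then 1
     else \<kappa> / x * integral {0..x} (\<lambda>t. (1 - t / x) powr (\<kappa> - 1) * cos t))"

definition young_summable ::
  "(nat \<Rightarrow> real) \<Rightarrow> real \<Rightarrow> (nat \<Rightarrow> complex) \<Rightarrow> complex \<Rightarrow> bool" where
  "young_summable lam \<kappa> c l \<longleftrightarrow>
     (\<exists>h0>0. \<forall>h. 0 < h \<and> h < h0 \<longrightarrow>
        summable (\<lambda>n. c n * complex_of_real (young_fun \<kappa> (lam n * h)))) \<and>
     ((\<lambda>h. \<Sum>n. c n * complex_of_real (young_fun \<kappa> (lam n * h))) \<longlongrightarrow> l) (at_right 0)"

definition L_summable ::
  "(nat \<Rightarrow> real) \<Rightarrow> (nat \<Rightarrow> complex) \<Rightarrow> complex \<Rightarrow> bool" where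
  "L_summable lam c l \<longleftrightarrow>
     young_summable lam 1 c l \<and>
     (\<exists>h0>0. \<forall>h. 0 < \<bar>h\<bar> \<and> \<bar>h\<bar> < h0 \<longrightarrow>
        summable (\<lambda>n. if lam n > 0
                        then c n * exp (\<i> * complex_of_real (lam n * h)) / complex_of_real (lam n * h)
                        else 0))"

end

theory Submission
  imports Defs
begin

text \<open>
  All six methods have the form \<open>\<Sum>n. c n * \<phi> (lam n * h) \<longrightarrow> \<phi> 0 * l\<close> as \<open>h \<longrightarrow> 0\<close> from
  the right, for a kernel \<open>\<phi>\<close> that is Lipschitz at \<open>0\<close> and \<open>O(1/u)\<close> at infinity. The growth
  hypothesis bounds \<open>\<Sum>n. norm (c n) * weight (lam n * h)\<close> uniformly in \<open>h\<close>, so the set of kernels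
  that sum the series to \<open>l\<close> is closed under limits that are uniform relative to \<open>weight\<close>. It is
  also closed under dilations, linear combinations, and averages \<open>\<integral> k(s) \<phi>(u \<tau>(s)) ds\<close>.

  Every method implies the one with kernel \<open>1/(1+u)\<close>: averaging \<open>(1-u)\<^sup>\<beta>\<close> against
  \<open>s\<^sup>\<beta> e\<^bsup>-s\<^esup>\<close> (with \<open>\<tau>(s) = 1/s\<close>) gives \<open>e\<^bsup>-u\<^esup>\<close>, which averages against \<open>e\<^bsup>-s\<^esup>\<close> to
  \<open>1/(1+u)\<close>; averaging \<open>\<gamma>\<^sub>\<kappa>\<close> against \<open>s\<^sup>\<kappa> e\<^bsup>-s\<^esup>\<close> gives \<open>1/(1+u\<^sup>2)\<close>, which averages against
  \<open>1/(1+s\<^sup>2)\<close> to \<open>1/(1+u)\<close>. Conversely, difference quotients of dilates of \<open>1/(1+u)\<close> produce all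
  its powers, and Weierstrass approximation in the variable \<open>x = 1/(1+u)\<close> then reaches every
  continuous admissible kernel.
\<close>


subsection \<open>Admissible kernels\<close>

text \<open>The square root of \<open>u / (1 + u)\<^sup>2\<close>, the natural error size for
  admissible kernels. It exceeds that error by a factor unbounded at 0 and at infinity, which is the
  slack spent in the polynomial approximation, yet it still decays like a power at both ends, so
  that sums over geometric blocks converge.\<close>

definition weight :: "real \<Rightarrow> real" where
  "weight u = sqrt u / (1 + u)"

lemma weight_nonneg: "u \<ge> 0 \<Longrightarrow> weight u \<ge> 0"
  by (simp add: weight_def)

lemma weight_0 [simp]: "weight 0 = 0"
  by (simp add: weight_def)

lemma weight_power2: "u \<ge> 0 \<Longrightarrow> (weight u)\<^sup>2 = u / (1 + u)\<^sup>2"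
  by (simp add: weight_def power_divide)

lemma weight_le_1: assumes "u \<ge> 0" shows "weight u \<le> 1"
proof -
  have "sqrt u \<le> sqrt ((1 + u)\<^sup>2)"
    using assms by (intro real_sqrt_le_mono) (simp add: power2_eq_square algebra_simps)
  then show ?thesis using assms by (simp add: weight_def)
qed

lemma weight_power2_le: "u \<ge> 0 \<Longrightarrow> u / (1 + u)\<^sup>2 \<le> weight u"
  using mult_left_le[OF weight_le_1[of u] weight_nonneg[of u]]
  by (simp only: weight_power2[symmetric]) (simp add: power2_eq_square)

lemma weight_le_inverse_sqrt:
  assumes "u > 0"
  shows "weight u \<le> 1 / sqrt u"
proof -
  have "sqrt u * sqrt u \<le> 1 + u" using assms by simp
  then show ?thesis using assms by (simp add: weight_def divide_simps)
qed

text \<open>Lipschitz behaviour at 0 and \<open>O(1/u)\<close> decay packed into one inequality: in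
  the variable \<open>x = 1 / (1 + u)\<close> it says that the kernel differs from
  \<open>\<phi> 0 * x\<close> by at most \<open>C * (x * (1 - x))\<close>.\<close>

definition admissible :: "(real \<Rightarrow> real) \<Rightarrow> bool" where
  "admissible \<phi> \<longleftrightarrow> (\<exists>C. \<forall>u\<ge>0. \<bar>\<phi> u - \<phi> 0 / (1 + u)\<bar> \<le> C * (u / (1 + u)\<^sup>2))"

lemma admissibleI:
  assumes near: "\<And>u. 0 \<le> u \<Longrightarrow> u \<le> 1 \<Longrightarrow> \<bar>\<phi> u - \<phi> 0\<bar> \<le> C * u"
    and far: "\<And>u. u \<ge> 1 \<Longrightarrow> \<bar>\<phi> u\<bar> \<le> C / u"
  shows "admissible \<phi>"
  unfolding admissible_def
proof (intro exI allI impI)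
  fix u :: real assume u: "u \<ge> 0"
  let ?K = "C + \<bar>\<phi> 0\<bar>"
  have "0 \<le> C" using near[of 1] by simp
  then have K: "?K \<ge> 0" by simp
  \<comment> \<open>The factor 4 covers both ranges: \<open>(1 + u)\<^sup>2\<close> is at most 4 for
    \<open>u \<le> 1\<close> and at most \<open>4 * u\<^sup>2\<close> for
    \<open>u \<ge> 1\<close>.\<close>
  show "\<bar>\<phi> u - \<phi> 0 / (1 + u)\<bar> \<le> (4 * ?K) * (u / (1 + u)\<^sup>2)"
  proof (cases "u \<le> 1")
    case True
    have "\<phi> u - \<phi> 0 / (1 + u) = (\<phi> u - \<phi> 0) + \<phi> 0 * (u / (1 + u))"
      using u by (simp add: field_simps)
    also have "\<bar>\<dots>\<bar> \<le> \<bar>\<phi> u - \<phi> 0\<bar> + \<bar>\<phi> 0 * (u / (1 + u))\<bar>"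
      by (rule abs_triangle_ineq)
    also have "\<bar>\<phi> 0 * (u / (1 + u))\<bar> = \<bar>\<phi> 0\<bar> * (u / (1 + u))"
      using u by (simp add: abs_mult)
    also have "\<bar>\<phi> u - \<phi> 0\<bar> + \<bar>\<phi> 0\<bar> * (u / (1 + u)) \<le> C * u + \<bar>\<phi> 0\<bar> * u"
      using u True by (intro add_mono near mult_left_mono) (auto simp: divide_simps mult_le_cancel_left1)
    also have "\<dots> = ?K * u" by (simp add: algebra_simps)
    also have "\<dots> \<le> ?K * (4 * (u / (1 + u)\<^sup>2))"
    proof (intro mult_left_mono K)
      have "(1 + u)\<^sup>2 \<le> 2\<^sup>2" using u True by (intro power_mono) auto
      then have "u * (1 + u)\<^sup>2 \<le> u * 4" using u by (intro mult_left_mono) auto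
      then show "u \<le> 4 * (u / (1 + u)\<^sup>2)" using u by (simp add: field_simps)
    qed
    finally show ?thesis by (simp only: ac_simps)
  next
    case False
    have "\<bar>\<phi> u - \<phi> 0 / (1 + u)\<bar> \<le> \<bar>\<phi> u\<bar> + \<bar>\<phi> 0\<bar> / (1 + u)"
      using u abs_triangle_ineq4[of "\<phi> u" "\<phi> 0 / (1 + u)"] by (simp add: abs_divide)
    also have "\<dots> \<le> C / u + \<bar>\<phi> 0\<bar> / u"
      using u False by (intro add_mono far divide_left_mono) auto
    also have "\<dots> = ?K * (1 / u)" by (simp add: add_divide_distrib)
    also have "\<dots> \<le> ?K * (4 * (u / (1 + u)\<^sup>2))"
    proof (intro mult_left_mono K)
      have "(1 + u)\<^sup>2 \<le> (2 * u)\<^sup>2" using u False by (intro power_mono) auto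
      then show "1 / u \<le> 4 * (u / (1 + u)\<^sup>2)"
        using u False by (simp add: divide_simps) (simp add: power2_eq_square)
    qed
    finally show ?thesis by (simp only: ac_simps)
  qed
qed

lemma admissible_bound:
  assumes "admissible \<phi>"
  obtains C where "C \<ge> 0" "\<And>u. u \<ge> 0 \<Longrightarrow> \<bar>\<phi> u\<bar> \<le> C / (1 + u)"
proof -
  obtain C where C: "\<And>u. u \<ge> 0 \<Longrightarrow> \<bar>\<phi> u - \<phi> 0 / (1 + u)\<bar> \<le> C * (u / (1 + u)\<^sup>2)"
    using assms by (auto simp: admissible_def)
  have b: "\<bar>\<phi> u\<bar> \<le> (\<bar>C\<bar> + \<bar>\<phi> 0\<bar>) / (1 + u)" if u: "u \<ge> 0" for u
  proof -
    have "\<bar>\<phi> u\<bar> \<le> \<bar>\<phi> u - \<phi> 0 / (1 + u)\<bar> + \<bar>\<phi> 0 / (1 + u)\<bar>" by linarith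
    also have "\<dots> \<le> C * (u / (1 + u)\<^sup>2) + \<bar>\<phi> 0\<bar> / (1 + u)"
      using C[OF u] u by (simp add: abs_divide)
    also have "C * (u / (1 + u)\<^sup>2) \<le> \<bar>C\<bar> * (1 / (1 + u))"
      using u by (intro mult_mono) (auto simp: divide_simps power2_eq_square)
    finally show ?thesis by (simp add: add_divide_distrib)
  qed
  show ?thesis by (rule that[OF _ b]) auto
qed

lemma admissible_add:
  assumes "admissible \<phi>" "admissible \<psi>"
  shows "admissible (\<lambda>u. \<phi> u + \<psi> u)"
proof -
  obtain C D where C: "\<And>u. u \<ge> 0 \<Longrightarrow> \<bar>\<phi> u - \<phi> 0 / (1 + u)\<bar> \<le> C * (u / (1 + u)\<^sup>2)"
    and D: "\<And>u. u \<ge> 0 \<Longrightarrow> \<bar>\<psi> u - \<psi> 0 / (1 + u)\<bar> \<le> D * (u / (1 + u)\<^sup>2)"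
    using assms by (auto simp: admissible_def)
  show ?thesis unfolding admissible_def
  proof (intro exI[of _ "C + D"] allI impI)
    fix u :: real assume "u \<ge> 0"
    then show "\<bar>\<phi> u + \<psi> u - (\<phi> 0 + \<psi> 0) / (1 + u)\<bar> \<le> (C + D) * (u / (1 + u)\<^sup>2)"
      using C[of u] D[of u] unfolding add_divide_distrib distrib_right by linarith
  qed
qed

lemma admissible_cmult:
  assumes "admissible \<phi>"
  shows "admissible (\<lambda>u. a * \<phi> u)"
proof -
  obtain C where C: "\<And>u. u \<ge> 0 \<Longrightarrow> \<bar>\<phi> u - \<phi> 0 / (1 + u)\<bar> \<le> C * (u / (1 + u)\<^sup>2)"
    using assms by (auto simp: admissible_def)
  show ?thesis unfolding admissible_def
  proof (intro exI[of _ "\<bar>a\<bar> * C"] allI impI)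
    fix u :: real assume "u \<ge> 0"
    have "a * \<phi> u - a * \<phi> 0 / (1 + u) = a * (\<phi> u - \<phi> 0 / (1 + u))"
      by (simp add: algebra_simps)
    then show "\<bar>a * \<phi> u - a * \<phi> 0 / (1 + u)\<bar> \<le> \<bar>a\<bar> * C * (u / (1 + u)\<^sup>2)"
      using mult_left_mono[OF C[OF \<open>u \<ge> 0\<close>], of "\<bar>a\<bar>"] by (simp add: abs_mult mult.assoc)
  qed
qed

section \<open>Admissibility of the standard kernels\<close>

lemma admissible_inverse_power:
  assumes "k \<ge> 1" "b > 0"
  shows "admissible (\<lambda>u. 1 / (1 + b * u) ^ k)"
\<comment> \<open>\<open>real k * b\<close> is the Lipschitz constant at 0 and \<open>1 / b\<close>
  the decay constant; their sum serves for both.\<close>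
proof (rule admissibleI[where C = "real k * b + 1 / b"])
  fix u :: real assume u: "0 \<le> u" "u \<le> 1"
  have bu: "0 \<le> b * u" using u assms by simp
  have ge1: "1 \<le> (1 + b * u) ^ k" using bu by (intro one_le_power) simp
  have "1 - real k * (b * u) \<le> 1 / (1 + b * u) ^ k"
  proof -
    have "1 + real k * (- (b * u / (1 + b * u))) \<le> (1 + - (b * u / (1 + b * u))) ^ k"
      using bu by (intro Bernoulli_inequality) (simp add: divide_simps)
    also have "1 + - (b * u / (1 + b * u)) = 1 / (1 + b * u)"
      using bu by (simp add: field_simps)
    also have "(1 / (1 + b * u)) ^ k = 1 / (1 + b * u) ^ k" by (simp add: power_divide)
    finally have "1 - real k * (b * u / (1 + b * u)) \<le> 1 / (1 + b * u) ^ k" by simp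
    moreover have "real k * (b * u / (1 + b * u)) \<le> real k * (b * u)"
      using bu by (intro mult_left_mono) (auto simp: divide_simps mult_le_cancel_left1)
    ultimately show ?thesis by linarith
  qed
  moreover have "1 / (1 + b * u) ^ k \<le> 1" using ge1 by (simp add: divide_simps)
  ultimately have "\<bar>1 / (1 + b * u) ^ k - 1\<bar> \<le> real k * (b * u)" by linarith
  also have "\<dots> \<le> (real k * b + 1 / b) * u" using u assms by (simp add: algebra_simps)
  finally show "\<bar>1 / (1 + b * u) ^ k - 1 / (1 + b * 0) ^ k\<bar> \<le> (real k * b + 1 / b) * u" by simp
next
  fix u :: real assume u: "u \<ge> 1"
  have bu: "0 < b * u" using u assms by simp
  have "(1 + b * u) ^ 1 \<le> (1 + b * u) ^ k" using bu assms by (intro power_increasing) auto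
  then have "b * u \<le> (1 + b * u) ^ k" by simp
  then have "1 / (1 + b * u) ^ k \<le> 1 / (b * u)" using bu by (intro divide_left_mono) auto
  also have "\<dots> \<le> (real k * b + 1 / b) / u" using u assms by (simp add: field_simps)
  finally show "\<bar>1 / (1 + b * u) ^ k\<bar> \<le> (real k * b + 1 / b) / u" using bu by simp
qed

text \<open>A first-order expansion at 0 whose remainder bound holds for all
  \<open>z \<ge> 0\<close>; it controls the difference quotient in
  \<open>sums_by_inverse_power_Suc\<close>. The constant \<open>(real k)\<^sup>2\<close> lets the
  induction close, because \<open>k^2 + (1 + k) \<le> (1 + k)^2\<close>.\<close>

lemma inverse_power_taylor:
  fixes z :: real
  assumes "z \<ge> 0"
  shows "\<bar>1 / (1 + z) ^ k - 1 + real k * z\<bar> \<le> (real k)\<^sup>2 * z\<^sup>2"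
proof (induction k)
  case (Suc k)
  define q where "q = 1 / (1 + z)"
  have q: "0 \<le> q" "q \<le> 1" "q * (1 + z) = 1" using assms by (auto simp: q_def)
  define a where "a = 1 / (1 + z) ^ k"
  have "a * q - 1 + (1 + real k) * z = q * (a - 1 + real k * z) + q * ((1 + real k) * z\<^sup>2)"
    using q(3) by algebra
  moreover have "\<bar>q * (a - 1 + real k * z)\<bar> \<le> (real k)\<^sup>2 * z\<^sup>2"
    using q(1,2) Suc.IH mult_left_le_one_le[of "\<bar>a - 1 + real k * z\<bar>" q]
    by (simp add: abs_mult a_def)
  moreover have "\<bar>q * ((1 + real k) * z\<^sup>2)\<bar> \<le> (1 + real k) * z\<^sup>2"
    using q(1,2) by (simp add: abs_mult mult_left_le_one_le)
  ultimately have "\<bar>a * q - 1 + (1 + real k) * z\<bar> \<le> (real k)\<^sup>2 * z\<^sup>2 + (1 + real k) * z\<^sup>2"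
    by linarith
  also have "\<dots> \<le> (1 + real k)\<^sup>2 * z\<^sup>2"
    using assms by (simp add: power2_eq_square algebra_simps)
  finally show ?case by (simp add: a_def q_def mult.commute)
qed simp

lemma admissible_exp: "admissible (\<lambda>u. exp (- u))"
proof (rule admissibleI[where C = 1])
  fix u :: real assume "0 \<le> u" "u \<le> 1"
  then show "\<bar>exp (- u) - exp (- 0)\<bar> \<le> 1 * u"
    using exp_ge_add_one_self[of "- u"] by simp
next
  fix u :: real assume "u \<ge> 1"
  moreover have "u \<le> exp u" using exp_ge_add_one_self[of u] by linarith
  ultimately show "\<bar>exp (- u)\<bar> \<le> 1 / u" by (simp add: exp_minus field_simps)
qed

lemma admissible_inverse_square: "admissible (\<lambda>u. 1 / (1 + u\<^sup>2))"
proof (rule admissibleI[where C = 1])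
  fix u :: real assume u: "0 \<le> u" "u \<le> 1"
  have p: "1 + u\<^sup>2 > 0" by (simp add: add_pos_nonneg)
  have "\<bar>1 / (1 + u\<^sup>2) - 1\<bar> = u\<^sup>2 / (1 + u\<^sup>2)"
    using p by (simp add: diff_divide_eq_iff)
  also have "\<dots> \<le> u\<^sup>2" using p by (simp add: divide_simps mult_le_cancel_left1)
  also have "\<dots> \<le> u" using u by (simp add: power2_eq_square mult_left_le)
  finally show "\<bar>1 / (1 + u\<^sup>2) - 1 / (1 + 0\<^sup>2)\<bar> \<le> 1 * u" by simp
next
  fix u :: real assume u: "u \<ge> 1"
  have "u \<le> u * u" using u by (simp add: mult_le_cancel_left1)
  then have "u \<le> 1 + u\<^sup>2" unfolding power2_eq_square by linarith
  then have "1 / (1 + u\<^sup>2) \<le> 1 / u" using u by (intro divide_left_mono) (auto intro!: mult_pos_pos add_pos_nonneg)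
  then show "\<bar>1 / (1 + u\<^sup>2)\<bar> \<le> 1 / u" by simp
qed

text \<open>The cut at 0 turns the sum over \<open>lam n \<le> x\<close> into a full series, since
  \<open>0 powr \<beta> = 0\<close>; the dilation parameter is \<open>h = 1 / x\<close>.\<close>

definition riesz_kernel :: "real \<Rightarrow> real \<Rightarrow> real" where
  "riesz_kernel \<beta> u = max 0 (1 - u) powr \<beta>"

lemma admissible_riesz_kernel:
  assumes "\<beta> > 0"
  shows "admissible (riesz_kernel \<beta>)"
proof (rule admissibleI)
  \<comment> \<open>Rounding the exponent up only lowers a power of a base in \<open>[0, 1]\<close>,
    so Bernoulli's inequality for the integer \<open>m\<close> bounds the real power from
    below.\<close>
  define m where "m = nat \<lceil>\<beta>\<rceil>"
  have m: "real m \<ge> \<beta>" "m > 0" using assms by (auto simp: m_def)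
  fix u :: real assume u: "0 \<le> u" "u \<le> 1"
  have "1 + real m * (- u) \<le> (1 + - u) ^ m" using u by (intro Bernoulli_inequality) simp
  also have "\<dots> \<le> (1 - u) powr \<beta>"
  proof (cases "u = 1")
    case False
    then have "(1 - u) ^ m = (1 - u) powr real m" using u by (simp add: powr_realpow)
    also have "\<dots> \<le> (1 - u) powr \<beta>" using u False m by (intro powr_mono') auto
    finally show ?thesis by simp
  qed (use m in \<open>simp add: power_0_left\<close>)
  finally have "1 - real m * u \<le> (1 - u) powr \<beta>" by simp
  moreover have "(1 - u) powr \<beta> \<le> 1" using u assms by (intro powr_le1) auto
  ultimately show "\<bar>riesz_kernel \<beta> u - riesz_kernel \<beta> 0\<bar> \<le> real (nat \<lceil>\<beta>\<rceil>) * u"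
    using u by (simp add: riesz_kernel_def m_def)
next
  fix u :: real assume "u \<ge> 1"
  then show "\<bar>riesz_kernel \<beta> u\<bar> \<le> real (nat \<lceil>\<beta>\<rceil>) / u" by (simp add: riesz_kernel_def)
qed

lemma continuous_riesz_kernel: "\<beta> > 0 \<Longrightarrow> continuous_on A (riesz_kernel \<beta>)"
  unfolding riesz_kernel_def by (intro continuous_on_powr' continuous_intros) auto

section \<open>Integral formulas behind the averages\<close>

lemma has_bochner_integral_Gamma_shift:
  fixes a r :: real
  assumes "a > 0"
  shows "has_bochner_integral lborel
    (\<lambda>s. indicator {r<..} s * (s - r) powr (a - 1) * exp (- s)) (Gamma a * exp (- r))"
proof -
  let ?g = "\<lambda>t::real. indicator {0..} t * t powr (a - 1) / exp t :: real"
  have "has_bochner_integral lborel ?g (Gamma a)"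
    using Gamma_conv_nn_integral_real[OF assms] Gamma_real_pos[OF assms]
    by (intro has_bochner_integral_nn_integral) auto
  then have "has_bochner_integral lborel (\<lambda>t. ?g t * exp (- r)) (Gamma a * exp (- r))"
    by (rule has_bochner_integral_mult_left)
  also have "(\<lambda>t. ?g t * exp (- r))
      = (\<lambda>t. indicator {r<..} (r + 1 * t) * (r + 1 * t - r) powr (a - 1) * exp (- (r + 1 * t)))"
    by (auto simp: fun_eq_iff indicator_def exp_diff exp_minus divide_simps exp_add)
  finally show ?thesis
    by (subst lborel_has_bochner_integral_real_affine_iff[of 1 _ _ r]) simp_all
qed

text \<open>For \<open>s > u\<close> the product of \<open>s powr \<beta>\<close> and the kernel is
  \<open>(s - u) powr \<beta>\<close>, so the integrand is that of a Gamma integral of order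
  \<open>\<beta> + 1\<close> shifted by \<open>u\<close>; for \<open>s \<le> u\<close> both
  integrands vanish.\<close>

lemma has_bochner_integral_riesz_kernel:
  assumes "\<beta> > 0" "u \<ge> 0"
  shows "has_bochner_integral lborel
    (\<lambda>s. indicator {0<..} s * s powr \<beta> * exp (- s) / Gamma (\<beta> + 1) * riesz_kernel \<beta> (u * (1 / s)))
    (exp (- u))"
proof -
  have G: "Gamma (\<beta> + 1) > 0" using assms by (intro Gamma_real_pos) simp
  have "has_bochner_integral lborel
    (\<lambda>s. (indicator {u<..} s * (s - u) powr (\<beta> + 1 - 1) * exp (- s)) / Gamma (\<beta> + 1))
    (Gamma (\<beta> + 1) * exp (- u) / Gamma (\<beta> + 1))"
    using assms by (intro has_bochner_integral_divide_zero has_bochner_integral_Gamma_shift) simp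
  moreover have "indicator {u<..} s * (s - u) powr (\<beta> + 1 - 1) * exp (- s) / Gamma (\<beta> + 1)
    = indicator {0<..} s * s powr \<beta> * exp (- s) / Gamma (\<beta> + 1) * riesz_kernel \<beta> (u * (1 / s))" for s
  proof (cases "s > u")
    case True
    then have "s > 0" using assms by simp
    have "s powr \<beta> * (1 - u / s) powr \<beta> = (s * (1 - u / s)) powr \<beta>"
      using True \<open>s > 0\<close> by (subst powr_mult) (auto simp: field_simps)
    also have "s * (1 - u / s) = s - u" using \<open>s > 0\<close> by (simp add: field_simps)
    finally show ?thesis using True \<open>s > 0\<close>
      by (simp add: riesz_kernel_def max_def field_simps)
  next
    case False
    then show ?thesis by (simp add: riesz_kernel_def max_def divide_simps indicator_def)
  qed
  ultimately have "has_bochner_integral lborel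
    (\<lambda>s. indicator {0<..} s * s powr \<beta> * exp (- s) / Gamma (\<beta> + 1) * riesz_kernel \<beta> (u * (1 / s)))
    (Gamma (\<beta> + 1) * exp (- u) / Gamma (\<beta> + 1))" by (simp only:)
  then show ?thesis using G by simp
qed

lemma has_bochner_integral_exp_Ioi:
  fixes u :: real
  assumes "u \<ge> 0"
  shows "has_bochner_integral lborel (\<lambda>s::real. indicator {0<..} s * exp (- s) * exp (- (u * s))) (1 / (1 + u))"
proof -
  let ?f = "\<lambda>s::real. indicator {0<..} s * exp (- s) :: real"
  have "has_bochner_integral lborel (\<lambda>s. indicator {0<..} s * (s - 0) powr (1 - 1) * exp (- s)) (Gamma 1 * exp (- 0) :: real)"
    by (intro has_bochner_integral_Gamma_shift) simp
  moreover have "(\<lambda>s. indicator {0<..} s * (s - 0) powr (1 - 1) * exp (- s)) = ?f"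
    by (auto simp: fun_eq_iff indicator_def)
  ultimately have "has_bochner_integral lborel ?f 1" by simp
  then have "has_bochner_integral lborel (\<lambda>s. ?f (0 + (1 + u) * s)) (1 /\<^sub>R \<bar>1 + u\<bar>)"
    using assms by (subst lborel_has_bochner_integral_real_affine_iff[of "1 + u" _ _ 0, symmetric]) auto
  moreover have "0 < (1 + u) * s \<longleftrightarrow> 0 < s" for s
    using assms by (simp add: zero_less_mult_iff)
  then have "(\<lambda>s. ?f (0 + (1 + u) * s)) = (\<lambda>s. indicator {0<..} s * exp (- s) * exp (- (u * s)))"
    by (simp add: fun_eq_iff indicator_def exp_add[symmetric]) (simp add: algebra_simps)
  ultimately show ?thesis using assms by (simp only:) (simp add: divide_inverse)
qed

text \<open>Nonnegativity yields integrability from the limit of the antiderivative alone. Passing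
  to the open half-line changes the integrand only at the point 0.\<close>

lemma has_bochner_integral_FTC_Ici:
  fixes f F :: "real \<Rightarrow> real"
  assumes "f \<in> borel_measurable borel" "\<And>x. x \<ge> 0 \<Longrightarrow> (F has_real_derivative f x) (at x)"
    and "\<And>x. x \<ge> 0 \<Longrightarrow> f x \<ge> 0" "(F \<longlongrightarrow> T) at_top" "T \<ge> F 0"
  shows "has_bochner_integral lborel (\<lambda>x. indicator {0<..} x * f x) (T - F 0)"
proof -
  have [measurable]: "f \<in> borel_measurable borel" by fact
  have ae: "AE x in lborel. x \<noteq> (0::real)" by (rule AE_lborel_singleton)
  have "has_bochner_integral lborel (\<lambda>x. indicator {0..} x * f x) (T - F 0)"
  proof (rule has_bochner_integral_nn_integral)
    have "(\<integral>\<^sup>+x. ennreal (indicator {0..} x * f x) \<partial>lborel) = (\<integral>\<^sup>+x. ennreal (f x) * indicator {0..} x \<partial>lborel)"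
      by (intro nn_integral_cong) (auto simp: indicator_def)
    also have "\<dots> = ennreal (T - F 0)"
      by (rule nn_integral_FTC_atLeast) (use assms in auto)
    finally show "(\<integral>\<^sup>+x. ennreal (indicator {0..} x * f x) \<partial>lborel) = ennreal (T - F 0)" .
  qed (use assms in \<open>auto simp: indicator_def\<close>)
  then show ?thesis
    by (rule has_bochner_integralI_AE)
       (use ae in \<open>auto elim!: eventually_mono simp: indicator_def\<close>)
qed

text \<open>Partial fractions in \<open>s\<close> give a difference of arctangents divided by
  \<open>1 - u\<^sup>2\<close>. They degenerate at \<open>u = 1\<close>, which therefore has its own
  antiderivative.\<close>

lemma has_bochner_integral_inverse_square:
  assumes u: "u \<ge> 0"
  shows "has_bochner_integral lborel
    (\<lambda>s. indicator {0<..} s * (2 / pi / (1 + s\<^sup>2)) * (1 / (1 + (u * s)\<^sup>2))) (1 / (1 + u))"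
proof -
  have p: "1 + x\<^sup>2 > 0" for x :: real by (simp add: add_pos_nonneg)
  let ?f = "\<lambda>s. 1 / (1 + s\<^sup>2) * (1 / (1 + (u * s)\<^sup>2))"
  have "has_bochner_integral lborel (\<lambda>s. indicator {0<..} s * ?f s) (pi / 2 * (1 / (1 + u)))"
  proof (cases "u = 1")
    case True
    let ?F = "\<lambda>s::real. (arctan s + s / (1 + s\<^sup>2)) / 2"
    have "has_bochner_integral lborel (\<lambda>s. indicator {0<..} s * ?f s) (pi / 4 - ?F 0)"
    proof (rule has_bochner_integral_FTC_Ici)
      fix x :: real
      have "x\<^sup>2 + 1 \<noteq> 0" using p[of x] by simp
      then show "(?F has_real_derivative ?f x) (at x)"
        using p[of x] True
        by (auto intro!: derivative_eq_intros)
           (simp add: divide_simps, simp add: algebra_simps power2_eq_square)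
    next
      show "(?F \<longlongrightarrow> pi / 4) at_top"
      proof -
        have "((\<lambda>s::real. s / (1 + s\<^sup>2)) \<longlongrightarrow> 0) at_top"
        proof (rule Lim_null_comparison)
          show "eventually (\<lambda>s::real. norm (s / (1 + s\<^sup>2)) \<le> inverse s) at_top"
            using eventually_gt_at_top[of 0] 
          proof eventually_elim
            case (elim s)
            have "s / (1 + s\<^sup>2) \<le> s / s\<^sup>2" using elim p[of s] by (intro divide_left_mono) auto
            then show ?case using elim p[of s] by (simp add: power2_eq_square field_simps)
          qed
          show "(inverse \<longlongrightarrow> (0::real)) at_top" by (rule tendsto_inverse_0_at_top[OF filterlim_ident])
        qed
        from tendsto_divide[OF tendsto_add[OF tendsto_arctan_at_top this] tendsto_const[of 2]]
        show ?thesis by simp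
      qed
    qed auto
    then show ?thesis using True by simp
  next
    case False
    define d where "d = 1 - u\<^sup>2"
    have d: "d \<noteq> 0" using False u by (auto simp: d_def power2_eq_1_iff)
    let ?F = "\<lambda>s. (arctan s - u * arctan (u * s)) / d"
    have lim: "(?F \<longlongrightarrow> pi / 2 * (1 / (1 + u))) at_top"
    \<comment> \<open>For \<open>u = 0\<close> the term \<open>arctan (u * s)\<close> stays 0
      instead of tending to \<open>pi / 2\<close>.\<close>
    proof (cases "u = 0")
      case True
      then show ?thesis using tendsto_arctan_at_top by (simp add: d_def)
    next
      case False
      then have "filterlim (\<lambda>s. u * s) at_top at_top"
        using u by (intro filterlim_tendsto_pos_mult_at_top[OF tendsto_const _ filterlim_ident]) auto
      from filterlim_compose[OF tendsto_arctan_at_top this]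
      have "((\<lambda>s. arctan (u * s)) \<longlongrightarrow> pi / 2) at_top" .
      then have "(?F \<longlongrightarrow> (pi / 2 - u * (pi / 2)) / d) at_top"
        by (intro tendsto_intros tendsto_arctan_at_top d)
      also have "(pi / 2 - u * (pi / 2)) / d = pi / 2 * (1 / (1 + u))"
        using d u by (simp add: d_def field_simps power2_eq_square)
      finally show ?thesis .
    qed
    have "has_bochner_integral lborel (\<lambda>s. indicator {0<..} s * ?f s) (pi / 2 * (1 / (1 + u)) - ?F 0)"
    proof (rule has_bochner_integral_FTC_Ici[OF _ _ _ lim])
      fix x :: real
      have e: "?f x = (inverse (1 + x\<^sup>2) - u * (inverse (1 + (u * x)\<^sup>2) * u)) / d"
        using p[of x] p[of "u * x"] d
        by (simp add: d_def divide_simps) (simp add: algebra_simps power2_eq_square)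
      show "(?F has_real_derivative ?f x) (at x)"
        unfolding e using d by (auto intro!: derivative_eq_intros)
    qed (use u in auto)
    then show ?thesis by simp
  qed
  then have "has_bochner_integral lborel (\<lambda>s. 2 / pi * (indicator {0<..} s * ?f s))
      (2 / pi * (pi / 2 * (1 / (1 + u))))"
    by (rule has_bochner_integral_mult_right)
  also have "2 / pi * (pi / 2 * (1 / (1 + u))) = 1 / (1 + u)"
    using u by (simp add: field_simps)
  finally show ?thesis by (simp add: mult_ac)
qed

text \<open>The real part of the Laplace integral of \<open>exp (- (1 - i u) r)\<close>, whose value
  is \<open>1 / (1 - i u)\<close>.\<close>

lemma has_bochner_integral_exp_cos:
  fixes u :: real
  shows "has_bochner_integral lborel (\<lambda>r. indicator {0<..} r * exp (- r) * cos (u * r)) (1 / (1 + u\<^sup>2))"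
proof -
  have p: "1 + u\<^sup>2 > 0" by (simp add: add_pos_nonneg)
  let ?F = "\<lambda>r. - exp (- r) + exp (- r) * (u * sin (u * r) - cos (u * r)) / (1 + u\<^sup>2)"
  let ?f = "\<lambda>r. exp (- r) * (1 + cos (u * r))"
  have e0: "((\<lambda>r::real. exp (- r)) \<longlongrightarrow> 0) at_top"
    using filterlim_compose[OF exp_at_bot filterlim_uminus_at_bot_at_top] by simp
  \<comment> \<open>Adding \<open>exp (- r)\<close> makes the integrand nonnegative.\<close>
  have "has_bochner_integral lborel (\<lambda>r. indicator {0<..} r * ?f r) (0 - ?F 0)"
  proof (rule has_bochner_integral_FTC_Ici)
    fix x :: real
    show "(?F has_real_derivative ?f x) (at x)"
      using p by (auto intro!: derivative_eq_intros)
        (simp add: divide_simps, simp add: algebra_simps power2_eq_square)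
    have "1 + cos (u * x) \<ge> 0" using cos_ge_minus_one[of "u * x"] by linarith
    then show "?f x \<ge> 0" by simp
  next
    have "((\<lambda>r. exp (- r) * (u * sin (u * r) - cos (u * r))) \<longlongrightarrow> 0) at_top"
    proof (rule Lim_null_comparison)
      show "eventually (\<lambda>r. norm (exp (- r) * (u * sin (u * r) - cos (u * r))) \<le> exp (- r) * (\<bar>u\<bar> + 1)) at_top"
      proof (intro always_eventually allI)
        fix r
        have "\<bar>u * sin (u * r)\<bar> \<le> \<bar>u\<bar>"
          using abs_sin_le_one[of "u * r"] by (simp add: abs_mult mult_left_le)
        then have "\<bar>u * sin (u * r) - cos (u * r)\<bar> \<le> \<bar>u\<bar> + 1"
          using abs_cos_le_one[of "u * r"] by linarith
        then show "norm (exp (- r) * (u * sin (u * r) - cos (u * r))) \<le> exp (- r) * (\<bar>u\<bar> + 1)"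
          by (simp add: abs_mult)
      qed
      show "((\<lambda>r. exp (- r) * (\<bar>u\<bar> + 1)) \<longlongrightarrow> 0) at_top"
        using tendsto_mult[OF e0 tendsto_const[of "\<bar>u\<bar> + 1"]] by simp
    qed
    from tendsto_add[OF tendsto_minus[OF e0] tendsto_divide[OF this tendsto_const[of "1 + u\<^sup>2"]]]
    show "(?F \<longlongrightarrow> 0) at_top" using p by simp
  qed (use p in \<open>auto simp: divide_simps\<close>)
  \<comment> \<open>The added exponential is taken off again; its integral is the case
    \<open>u = 0\<close> of \<open>has_bochner_integral_exp_Ioi\<close>.\<close>
  moreover have "has_bochner_integral lborel (\<lambda>s. indicator {0<..} s * exp (- s) * exp (- (0 * s))) (1 / (1 + 0) :: real)"
    by (rule has_bochner_integral_exp_Ioi) simp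
  ultimately have "has_bochner_integral lborel
     (\<lambda>r. indicator {0<..} r * ?f r - indicator {0<..} r * exp (- r) * exp (- (0 * r))) (0 - ?F 0 - 1 / (1 + 0))"
    by (rule has_bochner_integral_diff)
  then show ?thesis by (simp add: algebra_simps)
qed

subsection \<open>Young functions\<close>

text \<open>The integrand of the Young function moved to the unit interval, so that \<open>x\<close>
  enters through the cosine only. For \<open>\<kappa> = 1\<close> the value at \<open>t = 1\<close>
  is 0 because \<open>0 powr 0 = 0\<close>; this affects a null set.\<close>

definition young_integrand :: "real \<Rightarrow> real \<Rightarrow> real \<Rightarrow> real" where
  "young_integrand \<kappa> x t = indicator {0..1} t * ((1 - t) powr (\<kappa> - 1) * cos (x * t))"

lemma young_weight_bounds:
  "\<kappa> \<ge> 1 \<Longrightarrow> t \<in> {0..1} \<Longrightarrow> 0 \<le> (1 - t) powr (\<kappa> - 1) \<and> (1 - t) powr (\<kappa> - 1) \<le> 1"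
  for \<kappa> t :: real
  by (auto intro!: powr_le1)

lemma integrable_young_integrand:
  assumes "\<kappa> \<ge> 1"
  shows "integrable lborel (young_integrand \<kappa> x)"
proof (rule Bochner_Integration.integrable_bound)
  show "integrable lborel (indicator {0..1} :: real \<Rightarrow> real)" by simp
  show "young_integrand \<kappa> x \<in> borel_measurable lborel"
    unfolding young_integrand_def by measurable
  show "AE t in lborel. norm (young_integrand \<kappa> x t) \<le> norm (indicator {0..1} t :: real)"
  proof (intro AE_I2)
    fix t :: real
    show "norm (young_integrand \<kappa> x t) \<le> norm (indicator {0..1} t :: real)"
      using young_weight_bounds[OF assms, of t] abs_cos_le_one[of "x * t"]
        mult_le_one[of "(1 - t) powr (\<kappa> - 1)" "\<bar>cos (x * t)\<bar>"]
      by (auto simp: young_integrand_def indicator_def abs_mult)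
  qed
qed

text \<open>The substitution \<open>t = x * s\<close>. The frequency \<open>v\<close> is kept apart
  from the length \<open>x\<close>: \<open>v = 1\<close> serves the definition of the Young
  function, \<open>v = 0\<close> its normalisation, and \<open>v = u\<close> the inner integral of
  the Fubini argument.\<close>

lemma integral_young_scaled:
  fixes x :: real
  assumes "\<kappa> \<ge> 1" "x > 0"
  shows "set_integrable lborel {0..x} (\<lambda>t. (1 - t / x) powr (\<kappa> - 1) * cos (v * t))"
    and "(LBINT t:{0..x}. (1 - t / x) powr (\<kappa> - 1) * cos (v * t))
      = x * (LBINT t. young_integrand \<kappa> (v * x) t)"
proof -
  let ?f = "\<lambda>t. indicator {0..x} t *\<^sub>R ((1 - t / x) powr (\<kappa> - 1) * cos (v * t))"
  have eq: "?f (0 + x * t) = young_integrand \<kappa> (v * x) t" for t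
    using assms by (auto simp: young_integrand_def indicator_def mult_ac zero_le_mult_iff mult_le_cancel_left2)
  have "integrable lborel (\<lambda>t. ?f (0 + x * t))"
    unfolding eq by (rule integrable_young_integrand[OF assms(1)])
  then show "set_integrable lborel {0..x} (\<lambda>t. (1 - t / x) powr (\<kappa> - 1) * cos (v * t))"
    unfolding set_integrable_def using assms by (subst (asm) lborel_integrable_real_affine_iff) auto
  show "(LBINT t:{0..x}. (1 - t / x) powr (\<kappa> - 1) * cos (v * t)) = x * (LBINT t. young_integrand \<kappa> (v * x) t)"
    unfolding set_lebesgue_integral_def
    using assms by (subst lborel_integral_real_affine[of x _ 0]) (simp_all only: eq, simp_all)
qed

lemma integral_young_integrand_0:
  assumes "\<kappa> \<ge> 1"
  shows "(LBINT t. young_integrand \<kappa> 0 t) = 1 / \<kappa>"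
proof -
  have "((\<lambda>t. (1 - t) powr (\<kappa> - 1)) has_integral (- ((1 - 1) powr \<kappa> / \<kappa>)) - (- ((1 - 0) powr \<kappa> / \<kappa>))) {0..1::real}"
  proof (rule fundamental_theorem_of_calculus_interior)
    show "continuous_on {0..1} (\<lambda>t::real. - ((1 - t) powr \<kappa> / \<kappa>))"
      using assms by (intro continuous_intros continuous_on_powr') auto
    fix t :: real assume t: "t \<in> {0<..<1}"
    have "((\<lambda>t. - ((1 - t) powr \<kappa> / \<kappa>)) has_real_derivative (1 - t) powr (\<kappa> - 1)) (at t)"
      using t assms by (auto intro!: derivative_eq_intros)
    then show "((\<lambda>t. - ((1 - t) powr \<kappa> / \<kappa>)) has_vector_derivative (1 - t) powr (\<kappa> - 1)) (at t)"
      by (simp add: has_real_derivative_iff_has_vector_derivative)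
  qed simp
  then have "integral {0..1} (\<lambda>t::real. (1 - t / 1) powr (\<kappa> - 1) * cos (0 * t)) = 1 / \<kappa>"
    by (simp add: integral_unique)
  then show ?thesis
    using set_borel_integral_eq_integral(2)[OF integral_young_scaled(1)[OF assms zero_less_one, of 0]]
      integral_young_scaled(2)[OF assms zero_less_one, of 0] by simp
qed

lemma young_fun_eq_integral:
  assumes "\<kappa> \<ge> 1" "x \<ge> 0"
  shows "young_fun \<kappa> x = \<kappa> * (LBINT t. young_integrand \<kappa> x t)"
proof (cases "x = 0")
  case True
  then show ?thesis using assms integral_young_integrand_0[OF assms(1)] by (simp add: young_fun_def)
next
  case False
  then have x: "x > 0" using assms by simp
  have "integral {0..x} (\<lambda>t. (1 - t / x) powr (\<kappa> - 1) * cos (1 * t)) = x * (LBINT t. young_integrand \<kappa> (1 * x) t)"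
    using set_borel_integral_eq_integral(2)[OF integral_young_scaled(1)[OF assms(1) x, of 1]]
      integral_young_scaled(2)[OF assms(1) x, of 1] by metis
  then show ?thesis using x by (simp add: young_fun_def)
qed

text \<open>On the unit interval the cosines differ by at most \<open>\<bar>x - y\<bar> * t\<close>
  and the power weight is at most 1; \<open>\<kappa>\<close> is the prefactor of the
  integral.\<close>

lemma young_fun_lipschitz:
  assumes "\<kappa> \<ge> 1" "x \<ge> 0" "y \<ge> 0"
  shows "\<bar>young_fun \<kappa> x - young_fun \<kappa> y\<bar> \<le> \<kappa> * \<bar>x - y\<bar>"
proof -
  have i: "integrable lborel (\<lambda>t. young_integrand \<kappa> x t - young_integrand \<kappa> y t)"
    by (intro Bochner_Integration.integrable_diff integrable_young_integrand assms)
  have "\<bar>LBINT t. young_integrand \<kappa> x t - young_integrand \<kappa> y t\<bar>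
      \<le> (LBINT t. \<bar>young_integrand \<kappa> x t - young_integrand \<kappa> y t\<bar>)"
    by (rule integral_abs_bound)
  also have "\<dots> \<le> (LBINT t. indicator {0..1::real} t * \<bar>x - y\<bar>)"
  proof (rule integral_mono)
    show "integrable lborel (\<lambda>t. \<bar>young_integrand \<kappa> x t - young_integrand \<kappa> y t\<bar>)"
      using i by simp
    show "integrable lborel (\<lambda>t. indicator {0..1::real} t * \<bar>x - y\<bar>)" by simp
    fix t :: real
    show "\<bar>young_integrand \<kappa> x t - young_integrand \<kappa> y t\<bar> \<le> indicator {0..1::real} t * \<bar>x - y\<bar>"
    proof (cases "t \<in> {0..1}")
      case True
      let ?w = "(1 - t) powr (\<kappa> - 1)"
      have "\<bar>cos (x * t) - cos (y * t)\<bar> = 2 * \<bar>sin ((x * t + y * t) / 2)\<bar> * \<bar>sin ((y * t - x * t) / 2)\<bar>"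
        by (simp add: cos_diff_cos abs_mult)
      also have "\<dots> \<le> 2 * 1 * \<bar>(y * t - x * t) / 2\<bar>"
        by (intro mult_mono abs_sin_x_le_abs_x) auto
      also have "\<dots> = \<bar>x - y\<bar> * t"
        using True by (simp flip: left_diff_distrib add: abs_mult abs_minus_commute)
      also have "\<dots> \<le> \<bar>x - y\<bar>" using True by (simp add: mult_left_le)
      finally have c: "\<bar>cos (x * t) - cos (y * t)\<bar> \<le> \<bar>x - y\<bar>" .
      have "\<bar>young_integrand \<kappa> x t - young_integrand \<kappa> y t\<bar> = ?w * \<bar>cos (x * t) - cos (y * t)\<bar>"
        using True by (simp add: young_integrand_def flip: right_diff_distrib) (simp add: abs_mult)
      also have "\<dots> \<le> 1 * \<bar>x - y\<bar>"
        using young_weight_bounds[OF assms(1) True] c by (intro mult_mono) auto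
      finally show ?thesis using True by simp
    qed (simp add: young_integrand_def)
  qed
  also have "\<dots> = \<bar>x - y\<bar>" by simp
  finally have "\<bar>LBINT t. young_integrand \<kappa> x t - young_integrand \<kappa> y t\<bar> \<le> \<bar>x - y\<bar>" .
  then have "\<kappa> * \<bar>(LBINT t. young_integrand \<kappa> x t) - (LBINT t. young_integrand \<kappa> y t)\<bar> \<le> \<kappa> * \<bar>x - y\<bar>"
    using assms integrable_young_integrand by (intro mult_left_mono) (auto simp: Bochner_Integration.integral_diff)
  then show ?thesis
    using assms by (simp add: young_fun_eq_integral abs_mult flip: right_diff_distrib)
qed

lemma continuous_young_fun:
  assumes "\<kappa> \<ge> 1"
  shows "continuous_on {0..} (young_fun \<kappa>)"
proof (rule lipschitz_on_continuous_on)
  show "\<kappa>-lipschitz_on {0..} (young_fun \<kappa>)"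
    using assms young_fun_lipschitz[OF assms]
    by (intro lipschitz_onI) (auto simp: dist_real_def)
qed

text \<open>By the second mean value theorem a monotone weight times the cosine integrates to a
  value of the sine. The weight is negated because that theorem is applied to an increasing
  function.\<close>

lemma young_fun_decay:
  assumes "\<kappa> \<ge> 1" "x > 0"
  shows "\<bar>young_fun \<kappa> x\<bar> \<le> \<kappa> / x"
proof -
  let ?g = "\<lambda>t. - ((1 - t / x) powr (\<kappa> - 1))"
  have cos: "(cos has_integral sin b - sin 0) {0..b}" if "0 \<le> b" for b :: real
    using that by (intro fundamental_theorem_of_calculus)
      (auto intro!: derivative_eq_intros simp flip: has_real_derivative_iff_has_vector_derivative)
  have "cos integrable_on {0..x}" using cos[of x] assms by (auto simp: integrable_on_def)
  moreover have "?g s \<le> ?g t" if "0 \<le> s" "s \<le> t" "t \<le> x" for s t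
    using that assms by (simp, intro powr_mono2) (auto simp: divide_right_mono)
  \<comment> \<open>\<open>?g x\<close> is 0 also for \<open>\<kappa> = 1\<close>, by
    \<open>0 powr 0 = 0\<close>, so only the first of the two terms survives.\<close>
  ultimately obtain d where d: "d \<in> {0..x}"
    "integral {0..x} (\<lambda>t. ?g t * cos t) = ?g 0 * integral {0..d} cos + ?g x * integral {d..x} cos"
    using second_mean_value_theorem[of cos 0 x ?g] assms by auto
  have "integral {0..d} cos = sin d" using cos[of d] d by (simp add: integral_unique)
  then have "integral {0..x} (\<lambda>t. (1 - t / x) powr (\<kappa> - 1) * cos t) = sin d"
    using d(2) assms by simp
  then have "\<bar>young_fun \<kappa> x\<bar> = \<kappa> / x * \<bar>sin d\<bar>"
    using assms by (simp add: young_fun_def abs_mult)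
  also have "\<dots> \<le> \<kappa> / x * 1" using assms by (intro mult_left_mono) auto
  finally show ?thesis by simp
qed

lemma admissible_young_fun:
  assumes "\<kappa> \<ge> 1"
  shows "admissible (young_fun \<kappa>)"
proof (rule admissibleI)
  show "\<bar>young_fun \<kappa> u - young_fun \<kappa> 0\<bar> \<le> \<kappa> * u" if "0 \<le> u" "u \<le> 1" for u
    using young_fun_lipschitz[OF assms that(1), of 0] that by simp
  show "\<bar>young_fun \<kappa> u\<bar> \<le> \<kappa> / u" if "u \<ge> 1" for u
    using young_fun_decay[OF assms, of u] that by simp
qed

lemma young_fun_0 [simp]: "young_fun \<kappa> 0 = 1"
  by (simp add: young_fun_def)

text \<open>Fubini: \<open>s powr \<kappa> * young_fun \<kappa> (u * s)\<close> is
  \<open>\<kappa>\<close> times the integral of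
  \<open>(s - r) powr (\<kappa> - 1) * cos (u * r)\<close> over \<open>0 < r < s\<close>.
  Integrating over \<open>s\<close> first leaves a shifted Gamma integral, and then the Laplace
  integral of the cosine remains.\<close>

lemma has_bochner_integral_young_fun:
  assumes \<kappa>: "\<kappa> \<ge> 1" and u: "u \<ge> 0"
  shows "has_bochner_integral lborel
    (\<lambda>s. indicator {0<..} s * s powr \<kappa> * exp (- s) / Gamma (\<kappa> + 1) * young_fun \<kappa> (u * s))
    (1 / (1 + u\<^sup>2))"
proof -
  define f where "f = (\<lambda>r s. indicator {0<..} r * cos (u * r) *
    (indicator {r<..} s * (s - r) powr (\<kappa> - 1) * exp (- s)) :: real)"
  define g where "g = (\<lambda>r. indicator {0<..} r * exp (- r) * cos (u * r) :: real)"
  have G: "Gamma \<kappa> \<noteq> 0" using Gamma_real_pos[of \<kappa>] \<kappa> by linarith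
  have "\<kappa> \<notin> \<int>\<^sub>\<le>\<^sub>0" using \<kappa> nonpos_Ints_nonpos[of \<kappa>] by auto
  then have Gp: "Gamma (\<kappa> + 1) = \<kappa> * Gamma \<kappa>" by (rule Gamma_plus1)
  have hs: "has_bochner_integral lborel (f r) (Gamma \<kappa> * g r)" for r
    using has_bochner_integral_mult_right[OF has_bochner_integral_Gamma_shift[of \<kappa> r],
        of "indicator {0<..} r * cos (u * r)"] \<kappa>
    by (simp add: f_def g_def mult_ac)
  have hg: "has_bochner_integral lborel g (1 / (1 + u\<^sup>2))"
    unfolding g_def by (rule has_bochner_integral_exp_cos)
  have nf: "norm (f r s) = \<bar>indicator {0<..} r * cos (u * r)\<bar> *
      (indicator {r<..} s * (s - r) powr (\<kappa> - 1) * exp (- s))" for r s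
    by (simp add: f_def abs_mult)
  have hn: "(LBINT s. norm (f r s)) = Gamma \<kappa> * \<bar>g r\<bar>" for r
    unfolding nf using has_bochner_integral_integral_eq[OF has_bochner_integral_Gamma_shift[of \<kappa> r]] \<kappa>
    by (simp add: g_def abs_mult)
  have "{p. fst p < snd p} \<in> sets (borel :: (real \<times> real) measure)"
    by (intro borel_open open_Collect_less continuous_intros)
  then have [measurable]: "Measurable.pred (borel \<Otimes>\<^sub>M borel) (\<lambda>p::real \<times> real. fst p < snd p)"
    by (simp add: pred_def borel_prod)
  have meas: "case_prod f \<in> borel_measurable (lborel \<Otimes>\<^sub>M lborel)"
    unfolding f_def case_prod_beta' indicator_def greaterThan_iff by measurable
  \<comment> \<open>Absolute integrability holds because integrating \<open>norm (f r s)\<close>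
    over \<open>s\<close> gives \<open>Gamma \<kappa> * \<bar>g r\<bar>\<close>, and
    \<open>g\<close> is integrable.\<close>
  have int: "integrable (lborel \<Otimes>\<^sub>M lborel) (case_prod f)"
  proof (rule lborel_pair.Fubini_integrable[OF meas])
    show "integrable lborel (\<lambda>r. LBINT s. norm (case (r, s) of (x, xa) \<Rightarrow> f x xa))"
      using hg unfolding prod.case hn by (simp add: has_bochner_integral_iff)
    show "AE r in lborel. integrable lborel (\<lambda>s. case (r, s) of (x, xa) \<Rightarrow> f x xa)"
      using hs by (auto simp: has_bochner_integral_iff)
  qed
  have inner: "(LBINT r. f r s) = Gamma \<kappa> * (indicator {0<..} s * s powr \<kappa> * exp (- s) / Gamma (\<kappa> + 1) * young_fun \<kappa> (u * s))"
    for s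
  proof (cases "s > 0")
    case True
    have "(LBINT r. f r s) = (LBINT r. exp (- s) * s powr (\<kappa> - 1) *
        (indicator {0..s} r *\<^sub>R ((1 - r / s) powr (\<kappa> - 1) * cos (u * r))))"
    proof (rule integral_cong_AE)
      show "(\<lambda>r. f r s) \<in> borel_measurable lborel"
        unfolding f_def indicator_def greaterThan_iff by measurable
      \<comment> \<open>\<open>f\<close> lives on the open range \<open>0 < r < s\<close>, the
        scaled integral on the closed one; the two end points are discarded.\<close>
      have "AE r in lborel. r \<noteq> 0" "AE r in lborel. r \<noteq> s" by (rule AE_lborel_singleton)+
      then show "AE r in lborel. f r s = exp (- s) * s powr (\<kappa> - 1) *
        (indicator {0..s} r *\<^sub>R ((1 - r / s) powr (\<kappa> - 1) * cos (u * r)))"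
      proof eventually_elim
        case (elim r)
        show ?case
        proof (cases "0 < r \<and> r < s")
          case True
          then have "s powr (\<kappa> - 1) * (1 - r / s) powr (\<kappa> - 1) = (s * (1 - r / s)) powr (\<kappa> - 1)"
            by (subst powr_mult) (auto simp: field_simps)
          also have "s * (1 - r / s) = s - r" using True by (simp add: field_simps)
          finally show ?thesis using True by (simp add: f_def)
        qed (use elim in \<open>auto simp: f_def indicator_def\<close>)
      qed
    qed measurable
    also have "\<dots> = exp (- s) * s powr (\<kappa> - 1) * (s * (LBINT t. young_integrand \<kappa> (u * s) t))"
      using integral_young_scaled(2)[OF \<kappa> True, of u] by (simp add: set_lebesgue_integral_def)
    also have "\<dots> = exp (- s) * s powr \<kappa> * (young_fun \<kappa> (u * s) / \<kappa>)"
      using \<kappa> u True by (simp add: young_fun_eq_integral powr_diff)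
    finally show ?thesis
      unfolding Gp using True \<kappa> by (simp add: field_simps G)
  next
    case False
    then have "(\<lambda>r. f r s) = (\<lambda>_. 0)" by (auto simp: f_def indicator_def fun_eq_iff)
    then show ?thesis using False by simp
  qed
  have "integrable lborel (\<lambda>s. LBINT r. f r s)"
    by (rule lborel_pair.integrable_snd[OF int])
  moreover have "(LBINT s. LBINT r. f r s) = Gamma \<kappa> * (1 / (1 + u\<^sup>2))"
    using lborel_pair.integral_snd[OF int] lborel_pair.integral_fst[OF int]
      has_bochner_integral_integral_eq[OF hg] has_bochner_integral_integral_eq[OF hs] by simp
  ultimately have "has_bochner_integral lborel (\<lambda>s. 1 / Gamma \<kappa> * (LBINT r. f r s)) (1 / Gamma \<kappa> * (Gamma \<kappa> * (1 / (1 + u\<^sup>2))))"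
    by (intro has_bochner_integral_mult_right) (simp add: has_bochner_integral_iff)
  then show ?thesis unfolding inner by (simp add: G)
qed

subsection \<open>Series with slowly growing coefficients\<close>

locale slow_series =
  fixes lam :: "nat \<Rightarrow> real" and c :: "nat \<Rightarrow> complex"
  assumes nonneg: "\<And>n. lam n \<ge> 0"
    and infty: "filterlim lam at_top sequentially"
    and bound: "(\<lambda>x. \<Sum>n\<in>{n. lam n \<le> x}. lam n * norm (c n)) \<in> O[at_top](\<lambda>x. x)"
begin

lemma finite_level: "finite {n. lam n \<le> x}"
proof -
  have "eventually (\<lambda>n. lam n > x) sequentially"
    using infty by (simp add: filterlim_at_top_dense)
  then show ?thesis
    by (simp add: cofinite_eq_sequentially[symmetric] eventually_cofinite not_less)
qed

text \<open>The growth hypothesis speaks of large \<open>x\<close> only. Near 0 the sum vanishes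
  until the smallest positive \<open>lam n\<close>, and in between it is bounded, so a linear bound
  extends to all \<open>x \<ge> 0\<close>.\<close>

lemma level_sum_bound:
  obtains C where "C \<ge> 0" "\<And>x. x \<ge> 0 \<Longrightarrow> (\<Sum>n\<in>{n. lam n \<le> x}. lam n * norm (c n)) \<le> C * x"
proof -
  let ?T = "\<lambda>x. \<Sum>n\<in>{n. lam n \<le> x}. lam n * norm (c n)"
  have T_nonneg: "?T x \<ge> 0" for x by (intro sum_nonneg) (simp add: nonneg)
  have T_mono: "?T x \<le> ?T y" if "x \<le> y" for x y
    using that by (intro sum_mono2 finite_level) (auto simp: nonneg)
  obtain C X where C: "C > 0" and X: "\<And>x. x \<ge> X \<Longrightarrow> \<bar>?T x\<bar> \<le> C * \<bar>x\<bar>"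
    using bound by (auto simp: bigo_def eventually_at_top_linorder)
  define Y where "Y = max X 1"
  \<comment> \<open>The inserted 1 keeps the set nonempty when no positive \<open>lam n\<close> lies
    below \<open>Y\<close>.\<close>
  define m where "m = Min (insert 1 (lam ` {n. lam n \<le> Y} - {0}))"
  have fin: "finite (insert 1 (lam ` {n. lam n \<le> Y} - {0}))" by (simp add: finite_level)
  have m: "m > 0"
    unfolding m_def using fin nonneg by (subst Min_gr_iff) (auto simp: less_le)
  have m': "m \<le> lam n" if "lam n \<le> Y" "lam n \<noteq> 0" for n
    unfolding m_def using fin that by (intro Min_le) auto
  have "?T x \<le> (C + ?T Y / m) * x" if x: "x \<ge> 0" for x
  proof -
    consider "x \<ge> Y" | "x < m" "x < Y" | "m \<le> x" "x \<le> Y" by linarith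
    then show ?thesis
    proof cases
      case 1
      then have "?T x \<le> C * x" using X[of x] x by (auto simp: Y_def)
      also have "\<dots> \<le> (C + ?T Y / m) * x" using T_nonneg[of Y] m x by (simp add: distrib_right)
      finally show ?thesis .
    next
      case 2
      then have "?T x = 0" using m' by (intro sum.neutral) force
      then show ?thesis using C T_nonneg[of Y] m x by simp
    next
      case 3
      have "?T x \<le> ?T Y / m * m" using T_mono[OF 3(2)] m by simp
      also have "\<dots> \<le> ?T Y / m * x" using 3 m T_nonneg[of Y] by (intro mult_left_mono) auto
      also have "\<dots> \<le> (C + ?T Y / m) * x" using C x by (simp add: distrib_right)
      finally show ?thesis .
    qed
  qed
  then show ?thesis using that[of "C + ?T Y / m"] C T_nonneg[of Y] m by simp
qed

text \<open>Split at \<open>lam n = 1 / h\<close>: \<open>weight u\<close> is at most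
  \<open>sqrt u\<close> below and \<open>1 / sqrt u\<close> above, and blocks of ratio 4 contribute
  geometric series of ratio \<open>1 / 2\<close>. Uniformity in \<open>h\<close> is the point, as it
  makes approximation of kernels carry over to limits.\<close>

lemma finite_weight_sum_bound:
  obtains K where "\<And>h N. h > 0 \<Longrightarrow> finite N \<Longrightarrow> (\<Sum>n\<in>N. norm (c n) * weight (lam n * h)) \<le> K"
proof -
  obtain C where C: "C \<ge> 0"
    and T: "\<And>x. x \<ge> 0 \<Longrightarrow> (\<Sum>n\<in>{n. lam n \<le> x}. lam n * norm (c n)) \<le> C * x"
    using level_sum_bound by blast
  have T': "(\<Sum>n\<in>{n\<in>N. P n \<and> lam n \<le> x}. lam n * norm (c n)) \<le> C * x" if "x \<ge> 0" for x N P
  proof -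
    have "(\<Sum>n\<in>{n\<in>N. P n \<and> lam n \<le> x}. lam n * norm (c n))
        \<le> (\<Sum>n\<in>{n. lam n \<le> x}. lam n * norm (c n))"
      by (intro sum_mono2 finite_level) (auto simp: nonneg)
    then show ?thesis using T[OF that] by linarith
  qed
  \<comment> \<open>\<open>N\<close> is finite, so descending through \<open>x, x / 4, x / 16, \<dots>\<close> terminates; the claimed
    bound halves at each step, which absorbs the contribution of the range \<open>(x / 4, x]\<close>.\<close>
  have low: "(\<Sum>n\<in>{n\<in>N. lam n \<le> x}. norm (c n) * sqrt (lam n)) \<le> 4 * C * sqrt x"
    if "finite N" "x > 0" "\<And>n. n \<in> N \<Longrightarrow> lam n > x / 4 ^ k" for N x k
    using that
  proof (induction k arbitrary: x)
    case 0
    then have "{n\<in>N. lam n \<le> x} = {}" by force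
    then show ?case using 0 C by (simp only: sum.empty) simp
  next
    case (Suc k)
    let ?f = "\<lambda>n. norm (c n) * sqrt (lam n)"
    have "{n\<in>N. lam n \<le> x} = {n\<in>N. lam n \<le> x / 4} \<union> {n\<in>N. x / 4 < lam n \<and> lam n \<le> x}"
      using Suc.prems by auto
    then have "sum ?f {n\<in>N. lam n \<le> x}
        = sum ?f {n\<in>N. lam n \<le> x / 4} + sum ?f {n\<in>N. x / 4 < lam n \<and> lam n \<le> x}"
      using Suc.prems by (simp only:) (intro sum.union_disjoint, auto)
    also have "sum ?f {n\<in>N. lam n \<le> x / 4} \<le> 4 * C * sqrt (x / 4)"
      using Suc.prems by (intro Suc.IH) auto
    also have "4 * C * sqrt (x / 4) = 2 * C * sqrt x"
      using Suc.prems by (simp add: real_sqrt_divide)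
    also have "sum ?f {n\<in>N. x / 4 < lam n \<and> lam n \<le> x}
        \<le> (\<Sum>n\<in>{n\<in>N. x / 4 < lam n \<and> lam n \<le> x}. 2 / sqrt x * (lam n * norm (c n)))"
    proof (intro sum_mono)
      fix n assume n: "n \<in> {n\<in>N. x / 4 < lam n \<and> lam n \<le> x}"
      then have "sqrt (x / 4) \<le> sqrt (lam n)" by auto
      then have "sqrt x \<le> 2 * sqrt (lam n)" by (simp add: real_sqrt_divide)
      then have "sqrt x * sqrt (lam n) \<le> 2 * sqrt (lam n) * sqrt (lam n)"
        by (intro mult_right_mono) (auto simp: nonneg)
      also have "\<dots> = 2 * lam n" using nonneg[of n] by simp
      finally have "sqrt (lam n) \<le> 2 / sqrt x * lam n"
        using Suc.prems by (simp add: field_simps)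
      from mult_left_mono[OF this, of "norm (c n)"]
      show "?f n \<le> 2 / sqrt x * (lam n * norm (c n))" by (simp add: algebra_simps)
    qed
    also have "\<dots> \<le> 2 / sqrt x * (C * x)"
      unfolding sum_distrib_left[symmetric] using Suc.prems by (intro mult_left_mono T') auto
    also have "\<dots> = 2 * C * sqrt x" using Suc.prems by (simp add: field_simps)
    finally show ?case by simp
  qed
  \<comment> \<open>The mirror image of \<open>low\<close>, ascending through
    \<open>x, 4 * x, 16 * x, ...\<close>: the block up to \<open>4 * x\<close> costs
    \<open>4 * C / sqrt x\<close>, and the induction hypothesis at \<open>4 * x\<close> costs the
    same.\<close>
  have high: "(\<Sum>n\<in>{n\<in>N. lam n > x}. norm (c n) / sqrt (lam n)) \<le> 8 * C / sqrt x"
    if "finite N" "x > 0" "\<And>n. n \<in> N \<Longrightarrow> lam n \<le> x * 4 ^ k" for N x k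
    using that
  proof (induction k arbitrary: x)
    case 0
    then have "{n\<in>N. lam n > x} = {}" by force
    then show ?case using 0 C by (simp only: sum.empty) simp
  next
    case (Suc k)
    let ?f = "\<lambda>n. norm (c n) / sqrt (lam n)"
    have "{n\<in>N. lam n > x} = {n\<in>N. lam n > x * 4} \<union> {n\<in>N. x < lam n \<and> lam n \<le> x * 4}"
      using Suc.prems by auto
    then have "sum ?f {n\<in>N. lam n > x}
        = sum ?f {n\<in>N. lam n > x * 4} + sum ?f {n\<in>N. x < lam n \<and> lam n \<le> x * 4}"
      using Suc.prems by (simp only:) (intro sum.union_disjoint, auto)
    also have "sum ?f {n\<in>N. lam n > x * 4} \<le> 8 * C / sqrt (x * 4)"
      using Suc.prems by (intro Suc.IH) (auto simp: mult.assoc)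
    also have "8 * C / sqrt (x * 4) = 4 * C / sqrt x"
      using Suc.prems by (simp add: real_sqrt_mult)
    also have "sum ?f {n\<in>N. x < lam n \<and> lam n \<le> x * 4}
        \<le> (\<Sum>n\<in>{n\<in>N. x < lam n \<and> lam n \<le> x * 4}. 1 / (x * sqrt x) * (lam n * norm (c n)))"
    proof (intro sum_mono)
      fix n assume n: "n \<in> {n\<in>N. x < lam n \<and> lam n \<le> x * 4}"
      then have "x * sqrt x \<le> lam n * sqrt (lam n)"
        using Suc.prems by (intro mult_mono) auto
      then have "1 / sqrt (lam n) \<le> 1 / (x * sqrt x) * lam n"
        using Suc.prems n by (simp add: field_simps)
      from mult_left_mono[OF this, of "norm (c n)"]
      show "?f n \<le> 1 / (x * sqrt x) * (lam n * norm (c n))" by (simp add: algebra_simps)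
    qed
    also have "\<dots> \<le> 1 / (x * sqrt x) * (C * (x * 4))"
      unfolding sum_distrib_left[symmetric] using Suc.prems by (intro mult_left_mono T') auto
    also have "\<dots> = 4 * C / sqrt x" using Suc.prems by (simp add: field_simps)
    finally show ?case by simp
  qed
  have "(\<Sum>n\<in>N. norm (c n) * weight (lam n * h)) \<le> 12 * C" if h: "h > 0" and N: "finite N" for h N
  proof -
    let ?x = "1 / h"
    \<comment> \<open>Indices with \<open>lam n = 0\<close> have weight 0; on the others the
      finitely many values are bounded away from 0, so a depth \<open>k\<close> for
      \<open>low\<close> exists.\<close>
    let ?N = "{n\<in>N. lam n \<noteq> 0}"
    have pos: "lam n > 0" if "n \<in> ?N" for n using that nonneg[of n] by auto
    have x: "?x > 0" using h by simp
    have fN: "finite ?N" using N by simp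
    have "\<exists>k. \<forall>n\<in>?N. lam n > ?x / 4 ^ k"
    proof -
      have "\<forall>n\<in>?N. eventually (\<lambda>k. lam n > ?x / 4 ^ k) sequentially"
      proof
        fix n assume n: "n \<in> ?N"
        have "(\<lambda>k. ?x * (1 / 4) ^ k) \<longlonglongrightarrow> ?x * 0"
          by (intro tendsto_mult tendsto_const LIMSEQ_power_zero) simp
        then have "eventually (\<lambda>k. ?x * (1 / 4) ^ k < lam n) sequentially"
          using pos[OF n] by (intro order_tendstoD(2)) auto
        then show "eventually (\<lambda>k. lam n > ?x / 4 ^ k) sequentially"
          by (simp add: power_divide)
      qed
      then have "eventually (\<lambda>k. \<forall>n\<in>?N. lam n > ?x / 4 ^ k) sequentially"
        by (rule eventually_ball_finite[OF fN])
      then show ?thesis by (auto simp: eventually_sequentially)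
    qed
    then obtain k where k: "\<And>n. n \<in> ?N \<Longrightarrow> lam n > ?x / 4 ^ k" by blast
    have "\<exists>k. \<forall>n\<in>?N. lam n \<le> ?x * 4 ^ k"
    proof -
      have "\<forall>n\<in>?N. eventually (\<lambda>k. lam n \<le> ?x * 4 ^ k) sequentially"
      proof
        fix n
        obtain k0 where k0: "lam n * h < 4 ^ k0" using real_arch_pow[of 4 "lam n * h"] by auto
        show "eventually (\<lambda>k. lam n \<le> ?x * 4 ^ k) sequentially"
        proof (rule eventually_sequentiallyI)
          fix k assume "k0 \<le> k"
          then have "(4::real) ^ k0 \<le> 4 ^ k" by simp
          with k0 have "lam n * h \<le> 4 ^ k" by linarith
          then show "lam n \<le> ?x * 4 ^ k" using h by (simp add: field_simps)
        qed
      qed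
      then have "eventually (\<lambda>k. \<forall>n\<in>?N. lam n \<le> ?x * 4 ^ k) sequentially"
        by (rule eventually_ball_finite[OF fN])
      then show ?thesis by (auto simp: eventually_sequentially)
    qed
    then obtain k' where k': "\<And>n. n \<in> ?N \<Longrightarrow> lam n \<le> ?x * 4 ^ k'" by blast
    let ?f = "\<lambda>n. norm (c n) * weight (lam n * h)"
    have "sum ?f N = sum ?f ?N"
      using N by (intro sum.mono_neutral_right) auto
    also have "?N = {n\<in>?N. lam n \<le> ?x} \<union> {n\<in>?N. lam n > ?x}" by auto
    also have "sum ?f \<dots> = sum ?f {n\<in>?N. lam n \<le> ?x} + sum ?f {n\<in>?N. lam n > ?x}"
      using N by (intro sum.union_disjoint) auto
    also have "sum ?f {n\<in>?N. lam n \<le> ?x}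
        \<le> (\<Sum>n\<in>{n\<in>?N. lam n \<le> ?x}. sqrt h * (norm (c n) * sqrt (lam n)))"
    proof (intro sum_mono)
      fix n
      have "weight (lam n * h) \<le> sqrt (lam n * h)"
        using nonneg[of n] h by (simp add: weight_def divide_simps mult_le_cancel_left1)
      from mult_left_mono[OF this, of "norm (c n)"]
      show "?f n \<le> sqrt h * (norm (c n) * sqrt (lam n))"
        by (simp add: real_sqrt_mult algebra_simps)
    qed
    also have "\<dots> \<le> sqrt h * (4 * C * sqrt ?x)"
      unfolding sum_distrib_left[symmetric] using h k
      by (intro mult_left_mono low[OF fN x, of k]) auto
    also have "\<dots> = 4 * C" using h by (simp add: real_sqrt_divide)
    also have "sum ?f {n\<in>?N. lam n > ?x}
        \<le> (\<Sum>n\<in>{n\<in>?N. lam n > ?x}. 1 / sqrt h * (norm (c n) / sqrt (lam n)))"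
    proof (intro sum_mono)
      fix n assume n: "n \<in> {n\<in>?N. lam n > ?x}"
      then have p: "lam n * h > 0" using pos h by auto
      from mult_left_mono[OF weight_le_inverse_sqrt[OF p], of "norm (c n)"]
      show "?f n \<le> 1 / sqrt h * (norm (c n) / sqrt (lam n))"
        by (simp add: real_sqrt_mult mult.commute)
    qed
    also have "\<dots> \<le> 1 / sqrt h * (8 * C / sqrt ?x)"
      unfolding sum_distrib_left[symmetric] using h k'
      by (intro mult_left_mono high[OF fN x, of k']) auto
    also have "\<dots> = 8 * C" using h by (simp add: real_sqrt_divide)
    finally show ?thesis by simp
  qed
  then show ?thesis by (rule that)
qed

lemma summable_weight: "h > 0 \<Longrightarrow> summable (\<lambda>n. norm (c n) * weight (lam n * h))"
proof -
  assume h: "h > 0"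
  obtain K where "\<And>h N. h > 0 \<Longrightarrow> finite N \<Longrightarrow> (\<Sum>n\<in>N. norm (c n) * weight (lam n * h)) \<le> K"
    using finite_weight_sum_bound by blast
  then show ?thesis using h nonneg
    by (intro summableI_nonneg_bounded[where x = K]) (auto intro!: mult_nonneg_nonneg weight_nonneg)
qed

lemma weight_series_bound:
  obtains K where "K > 0" "\<And>h. h > 0 \<Longrightarrow> (\<Sum>n. norm (c n) * weight (lam n * h)) \<le> K"
proof -
  obtain K where K: "\<And>h N. h > 0 \<Longrightarrow> finite N \<Longrightarrow> (\<Sum>n\<in>N. norm (c n) * weight (lam n * h)) \<le> K"
    using finite_weight_sum_bound by blast
  show ?thesis
  proof (rule that)
    show "max K 1 > 0" by simp
    show "(\<Sum>n. norm (c n) * weight (lam n * h)) \<le> max K 1" if "h > 0" for h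
      by (intro suminf_le_const summable_weight that) (use K[OF that] in \<open>simp add: le_max_iff_disj\<close>)
  qed
qed

lemma eventually_lam_ge: "eventually (\<lambda>n. lam n \<ge> x) sequentially"
  using infty by (simp add: filterlim_at_top)

text \<open>\<open>weight\<close> decays more slowly than \<open>1 / (1 + u)\<close>, so it
  dominates in the tail; near \<open>u = 0\<close> it vanishes, whence only
  \<open>lam n \<ge> 1\<close> is compared. This gives absolute convergence for each fixed
  \<open>h\<close>, while the factor \<open>1 / sqrt h\<close> in the comparison is not
  uniform.\<close>

lemma summable_decay:
  assumes h: "h > 0"
  shows "summable (\<lambda>n. norm (c n) / (1 + lam n * h))"
proof (rule summable_comparison_test_ev)
  show "summable (\<lambda>n. 1 / sqrt h * (norm (c n) * weight (lam n * h)))"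
    by (intro summable_mult summable_weight h)
  show "eventually (\<lambda>n. norm (norm (c n) / (1 + lam n * h)) \<le> 1 / sqrt h * (norm (c n) * weight (lam n * h))) sequentially"
    using eventually_lam_ge[of 1]
  proof eventually_elim
    case (elim n)
    have "1 / (1 + lam n * h) \<le> sqrt (lam n) / (1 + lam n * h)"
      using elim h by (intro divide_right_mono) auto
    also have "\<dots> = 1 / sqrt h * weight (lam n * h)"
      using h by (simp add: weight_def real_sqrt_mult)
    finally have "norm (c n) * (1 / (1 + lam n * h)) \<le> norm (c n) * (1 / sqrt h * weight (lam n * h))"
      by (intro mult_left_mono) auto
    then show ?case using h elim by (simp add: algebra_simps)
  qed
qed

section \<open>Kernel transforms and closure properties of the summing kernels\<close>

definition transform :: "(real \<Rightarrow> real) \<Rightarrow> real \<Rightarrow> complex" where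
  "transform \<phi> h = (\<Sum>n. c n * complex_of_real (\<phi> (lam n * h)))"

lemma summable_norm_admissible:
  assumes "admissible \<phi>" "h > 0"
  shows "summable (\<lambda>n. norm (c n * complex_of_real (\<phi> (lam n * h))))"
proof -
  obtain C where C: "\<And>u. u \<ge> 0 \<Longrightarrow> \<bar>\<phi> u\<bar> \<le> C / (1 + u)"
    using admissible_bound[OF assms(1)] by blast
  show ?thesis
  proof (rule summable_comparison_test)
    show "summable (\<lambda>n. C * (norm (c n) / (1 + lam n * h)))"
      by (intro summable_mult summable_decay assms)
    show "\<exists>N. \<forall>n\<ge>N. norm (norm (c n * complex_of_real (\<phi> (lam n * h)))) \<le> C * (norm (c n) / (1 + lam n * h))"
    proof (intro exI allI impI)
      fix n
      show "norm (norm (c n * complex_of_real (\<phi> (lam n * h)))) \<le> C * (norm (c n) / (1 + lam n * h))"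
        using mult_left_mono[OF C[of "lam n * h"], of "norm (c n)"] nonneg[of n] assms(2)
        by (simp add: norm_mult algebra_simps)
    qed
  qed
qed

lemma summable_admissible:
  assumes "admissible \<phi>" "h > 0"
  shows "summable (\<lambda>n. c n * complex_of_real (\<phi> (lam n * h)))"
  using summable_norm_admissible[OF assms] by (rule summable_norm_cancel)

lemma transform_diff_bound:
  assumes "admissible \<phi>" "admissible \<psi>" "h > 0"
    and close: "\<And>u. u \<ge> 0 \<Longrightarrow> \<bar>\<phi> u - \<psi> u\<bar> \<le> e * weight u"
  shows "norm (transform \<phi> h - transform \<psi> h) \<le> e * (\<Sum>n. norm (c n) * weight (lam n * h))"
proof -
  have s: "summable (\<lambda>n. c n * complex_of_real (\<phi> (lam n * h)) - c n * complex_of_real (\<psi> (lam n * h)))"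
    by (intro summable_diff summable_admissible assms)
  have "transform \<phi> h - transform \<psi> h
      = (\<Sum>n. c n * complex_of_real (\<phi> (lam n * h)) - c n * complex_of_real (\<psi> (lam n * h)))"
    unfolding transform_def by (intro suminf_diff summable_admissible assms)
  also have "norm \<dots> \<le> (\<Sum>n. e * (norm (c n) * weight (lam n * h)))"
  proof (intro norm_suminf_le summable_mult summable_weight assms)
    fix n
    have "norm (c n * complex_of_real (\<phi> (lam n * h)) - c n * complex_of_real (\<psi> (lam n * h)))
        = norm (c n) * \<bar>\<phi> (lam n * h) - \<psi> (lam n * h)\<bar>"
      by (simp flip: right_diff_distrib of_real_diff add: norm_mult)
    also have "\<dots> \<le> norm (c n) * (e * weight (lam n * h))"
      using nonneg[of n] assms(3) by (intro mult_left_mono close) auto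
    finally show "norm (c n * complex_of_real (\<phi> (lam n * h)) - c n * complex_of_real (\<psi> (lam n * h)))
        \<le> e * (norm (c n) * weight (lam n * h))" by (simp add: algebra_simps)
  qed
  also have "\<dots> = e * (\<Sum>n. norm (c n) * weight (lam n * h))"
    by (intro suminf_mult summable_weight assms)
  finally show ?thesis .
qed

text \<open>The factor \<open>\<phi> 0\<close> makes the notion compatible with linear combinations,
  whose members need not be normalised. Convergence of the series is left to
  \<open>admissible\<close>.\<close>

definition sums_by :: "(real \<Rightarrow> real) \<Rightarrow> complex \<Rightarrow> bool" where
  "sums_by \<phi> l \<longleftrightarrow> (transform \<phi> \<longlongrightarrow> complex_of_real (\<phi> 0) * l) (at_right 0)"

text \<open>The bound \<open>K\<close> on the weighted series holds for all \<open>h\<close> at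
  once, so the two transforms differ by at most \<open>e * K\<close> uniformly as \<open>h\<close>
  tends to 0.\<close>

lemma sums_by_approx:
  assumes adm: "admissible \<phi>"
    and approx: "\<And>e. e > 0 \<Longrightarrow> \<exists>\<psi>. admissible \<psi> \<and> sums_by \<psi> l \<and> (\<forall>u\<ge>0. \<bar>\<phi> u - \<psi> u\<bar> \<le> e * weight u)"
  shows "sums_by \<phi> l"
  unfolding sums_by_def
proof (rule tendstoI)
  fix e :: real assume e: "e > 0"
  obtain K where K: "K > 0" "\<And>h. h > 0 \<Longrightarrow> (\<Sum>n. norm (c n) * weight (lam n * h)) \<le> K"
    using weight_series_bound by blast
  define d where "d = e / (2 * K)"
  have d: "d > 0" using e K by (simp add: d_def)
  obtain \<psi> where \<psi>: "admissible \<psi>" "sums_by \<psi> l" "\<And>u. u \<ge> 0 \<Longrightarrow> \<bar>\<phi> u - \<psi> u\<bar> \<le> d * weight u"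
    using approx[OF d] by blast
  \<comment> \<open>As \<open>weight 0 = 0\<close>, the approximating kernel agrees at 0 and has
    exactly the same limit.\<close>
  have eq: "\<psi> 0 = \<phi> 0" using \<psi>(3)[of 0] by simp
  have "eventually (\<lambda>h. dist (transform \<psi> h) (complex_of_real (\<phi> 0) * l) < e / 2) (at_right 0)"
    using \<psi>(2) half_gt_zero[OF e] unfolding sums_by_def eq by (rule tendstoD)
  moreover have "eventually (\<lambda>h. h > (0::real)) (at_right 0)"
    by (simp add: eventually_at_right_less)
  ultimately show "eventually (\<lambda>h. dist (transform \<phi> h) (complex_of_real (\<phi> 0) * l) < e) (at_right 0)"
  proof eventually_elim
    case (elim h)
    have "norm (transform \<phi> h - transform \<psi> h) \<le> d * (\<Sum>n. norm (c n) * weight (lam n * h))"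
      by (intro transform_diff_bound adm \<psi> elim)
    also have "\<dots> \<le> d * K" using d K(2)[OF elim(2)] by (intro mult_left_mono) auto
    also have "\<dots> = e / 2" using K by (simp add: d_def)
    finally have "dist (transform \<phi> h) (transform \<psi> h) \<le> e / 2" by (simp add: dist_norm)
    then show ?case
      using elim(1) dist_triangle[of "transform \<phi> h" "complex_of_real (\<phi> 0) * l" "transform \<psi> h"]
      by linarith
  qed
qed

lemma sums_by_add:
  assumes "admissible \<phi>" "admissible \<psi>" "sums_by \<phi> l" "sums_by \<psi> l"
  shows "sums_by (\<lambda>u. \<phi> u + \<psi> u) l"
proof -
  have "((\<lambda>h. transform \<phi> h + transform \<psi> h)
      \<longlongrightarrow> complex_of_real (\<phi> 0) * l + complex_of_real (\<psi> 0) * l) (at_right 0)"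
    using assms(3,4) unfolding sums_by_def by (intro tendsto_add)
  moreover have "eventually (\<lambda>h. transform \<phi> h + transform \<psi> h = transform (\<lambda>u. \<phi> u + \<psi> u) h) (at_right 0)"
    using eventually_at_right_less[of "0::real"]
  proof eventually_elim
    case (elim h)
    show ?case unfolding transform_def
      by (subst suminf_add[OF summable_admissible summable_admissible])
         (use assms elim in \<open>auto simp: algebra_simps\<close>)
  qed
  ultimately have "(transform (\<lambda>u. \<phi> u + \<psi> u)
      \<longlongrightarrow> complex_of_real (\<phi> 0) * l + complex_of_real (\<psi> 0) * l) (at_right 0)"
    by (rule Lim_transform_eventually)
  then show ?thesis by (simp add: sums_by_def algebra_simps)
qed

lemma sums_by_cmult:
  assumes "admissible \<phi>" "sums_by \<phi> l"
  shows "sums_by (\<lambda>u. a * \<phi> u) l"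
proof -
  have "((\<lambda>h. complex_of_real a * transform \<phi> h)
      \<longlongrightarrow> complex_of_real a * (complex_of_real (\<phi> 0) * l)) (at_right 0)"
    using assms(2) unfolding sums_by_def by (intro tendsto_mult tendsto_const)
  moreover have "eventually (\<lambda>h. complex_of_real a * transform \<phi> h = transform (\<lambda>u. a * \<phi> u) h) (at_right 0)"
    using eventually_at_right_less[of "0::real"]
  proof eventually_elim
    case (elim h)
    show ?case unfolding transform_def
      by (subst suminf_mult[OF summable_admissible, symmetric])
         (use assms elim in \<open>auto simp: algebra_simps\<close>)
  qed
  ultimately have "(transform (\<lambda>u. a * \<phi> u)
      \<longlongrightarrow> complex_of_real a * (complex_of_real (\<phi> 0) * l)) (at_right 0)"
    by (rule Lim_transform_eventually)
  then show ?thesis by (simp add: sums_by_def algebra_simps)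
qed

lemma sums_by_scale:
  assumes "sums_by \<phi> l" "b > 0"
  shows "sums_by (\<lambda>u. \<phi> (b * u)) l"
proof -
  have "filterlim (\<lambda>h. b * h) (at_right 0) (at_right (0::real))"
    using filterlim_times_pos[OF filterlim_ident assms(2), of 0] by simp
  then have "((\<lambda>h. transform \<phi> (b * h)) \<longlongrightarrow> complex_of_real (\<phi> 0) * l) (at_right 0)"
    using assms(1) unfolding sums_by_def by (rule filterlim_compose[rotated])
  then show ?thesis by (simp add: sums_by_def transform_def[abs_def] mult.left_commute[of b])
qed

subsection \<open>The Tauberian step\<close>

text \<open>
  Since \<open>u / (1 + u) ^ Suc k = 1 / (1 + u) ^ k - 1 / (1 + u) ^ Suc k\<close>, the derivative of
  \<open>1 / (1 + b * u) ^ k\<close> with respect to \<open>b\<close> at \<open>b = 1\<close> yields the next power.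
\<close>

lemma sums_by_inverse_power_Suc:
  assumes k: "k \<ge> 1" and sum: "sums_by (\<lambda>u. 1 / (1 + u) ^ k) l"
  shows "sums_by (\<lambda>u. 1 / (1 + u) ^ Suc k) l"
proof (rule sums_by_approx)
  show "admissible (\<lambda>u. 1 / (1 + u) ^ Suc k)"
    using admissible_inverse_power[of "Suc k" 1] by simp
next
  fix e :: real assume e: "e > 0"
  \<comment> \<open>The Taylor remainder \<open>(real k)\<^sup>2 * (d * r)\<^sup>2\<close>, divided
    by \<open>real k * d\<close>, then becomes \<open>e * r\<^sup>2\<close>.\<close>
  define d where "d = e / real k"
  have d: "d > 0" using e k by (simp add: d_def)
  let ?p = "\<lambda>u::real. 1 / (1 + u) ^ k"
  let ?q = "\<lambda>u. 1 / (1 + (1 + d) * u) ^ k"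
  \<comment> \<open>This is \<open>?p + (?q - ?p) / (real k * d)\<close>: the quotient approximates
    \<open>- u / (1 + u) ^ Suc k\<close>, which added to \<open>?p\<close> gives the next
    power.\<close>
  define \<psi> where "\<psi> = (\<lambda>u. (1 - 1 / (real k * d)) * ?p u + 1 / (real k * d) * ?q u)"
  have p: "admissible ?p" using admissible_inverse_power[OF k, of 1] by simp
  have q: "admissible ?q" using admissible_inverse_power[OF k, of "1 + d"] d by simp
  have sq: "sums_by ?q l" using sums_by_scale[OF sum, of "1 + d"] d by simp
  have "admissible \<psi>" unfolding \<psi>_def by (intro admissible_add admissible_cmult p q)
  moreover have "sums_by \<psi> l"
    unfolding \<psi>_def by (intro sums_by_add sums_by_cmult admissible_cmult p q sq sum)
  moreover have "\<bar>1 / (1 + u) ^ Suc k - \<psi> u\<bar> \<le> e * weight u" if u: "u \<ge> 0" for u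
  proof -
    define r where "r = u / (1 + u)"
    define t where "t = 1 / (1 + u)"
    have r: "0 \<le> r" "r \<le> 1" and t: "0 \<le> t" "t \<le> 1" "t = 1 - r"
      using u by (auto simp: r_def t_def field_simps)
    \<comment> \<open>This factorisation moves the expansion to the variable \<open>d * r\<close>,
      where \<open>r \<le> 1\<close> makes the remainder uniform in \<open>u\<close>.\<close>
    have "1 + (1 + d) * u = (1 + u) * (1 + d * r)"
      using u by (simp add: r_def field_simps)
    then have qe: "?q u = t ^ k * (1 / (1 + d * r) ^ k)"
      by (simp add: t_def power_mult_distrib power_divide)
    have pe: "?p u = t ^ k" by (simp add: t_def power_divide)
    define w where "w = 1 / (1 + d * r) ^ k"
    have "1 / (1 + u) ^ Suc k = t ^ k * t" by (simp add: t_def power_divide)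
    also have "\<dots> = t ^ k * (1 - r)" using t(3) by simp
    finally have e1: "1 / (1 + u) ^ Suc k = t ^ k * (1 - r)" .
    have "1 / (1 + u) ^ Suc k - \<psi> u
        = - (t ^ k * (1 / (1 + d * r) ^ k - 1 + real k * (d * r)) / (real k * d))"
      unfolding \<psi>_def qe pe e1 w_def[symmetric] using d k by (simp add: field_simps)
    also have "\<bar>\<dots>\<bar> = t ^ k * \<bar>1 / (1 + d * r) ^ k - 1 + real k * (d * r)\<bar> / (real k * d)"
      using d k t by (simp add: abs_mult)
    also have "\<dots> \<le> t ^ k * ((real k)\<^sup>2 * (d * r)\<^sup>2) / (real k * d)"
      using d k t r by (intro divide_right_mono mult_left_mono inverse_power_taylor) auto
    also have "\<dots> = e * (t ^ k * r\<^sup>2)"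
      using d k by (simp add: d_def power2_eq_square field_simps)
    \<comment> \<open>One factor of each suffices: \<open>t\<close> supplies decay at infinity and
      \<open>r\<close> vanishing at 0.\<close>
    also have "t ^ k * r\<^sup>2 \<le> t ^ 1 * r ^ 1"
      using t r k by (intro mult_mono power_decreasing) auto
    also have "t ^ 1 * r ^ 1 = u / (1 + u)\<^sup>2" by (simp add: t_def r_def power2_eq_square)
    also have "\<dots> \<le> weight u" using u by (rule weight_power2_le)
    finally show ?thesis using e by simp
  qed
  ultimately show "\<exists>\<psi>. admissible \<psi> \<and> sums_by \<psi> l \<and> (\<forall>u\<ge>0. \<bar>1 / (1 + u) ^ Suc k - \<psi> u\<bar> \<le> e * weight u)"
    by blast
qed

lemma sums_by_inverse_power:
  assumes "k \<ge> 1" "sums_by (\<lambda>u. 1 / (1 + u)) l"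
  shows "sums_by (\<lambda>u. 1 / (1 + u) ^ k) l"
  using assms(1)
proof (induction k rule: dec_induct)
  case base
  then show ?case using assms(2) by simp
qed (rule sums_by_inverse_power_Suc)

text \<open>Polynomials in \<open>1 / (1 + u)\<close> without constant term: exponents start at 1
  because a nonzero constant kernel does not decay.\<close>

lemma sums_by_polynomial:
  assumes "sums_by (\<lambda>u. 1 / (1 + u)) l"
  shows "admissible (\<lambda>u. \<Sum>i\<le>n. a i * (1 / (1 + u) ^ Suc i))
    \<and> sums_by (\<lambda>u. \<Sum>i\<le>n. a i * (1 / (1 + u) ^ Suc i)) l"
proof -
  have A: "admissible (\<lambda>u. 1 / (1 + u) ^ Suc i)" for i
    using admissible_inverse_power[of "Suc i" 1] by simp
  have S: "sums_by (\<lambda>u. 1 / (1 + u) ^ Suc i) l" for i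
    using assms by (intro sums_by_inverse_power) auto
  note AS = admissible_cmult[OF A] sums_by_cmult[OF A S]
  show ?thesis
  proof (induction n)
    case 0
    then show ?case using AS[of "a 0" 0] by simp
  next
    case (Suc n)
    have "admissible (\<lambda>u. (\<Sum>i\<le>n. a i * (1 / (1 + u) ^ Suc i)) + a (Suc n) * (1 / (1 + u) ^ Suc (Suc n)))"
      using Suc by (intro admissible_add AS) auto
    moreover have "sums_by (\<lambda>u. (\<Sum>i\<le>n. a i * (1 / (1 + u) ^ Suc i)) + a (Suc n) * (1 / (1 + u) ^ Suc (Suc n))) l"
      using Suc by (intro sums_by_add AS) auto
    ultimately show ?case by simp
  qed
qed

text \<open>With \<open>x = 1 / (1 + u)\<close>, approximate the remainder \<open>D x\<close> of
  \<open>\<phi>\<close> over \<open>\<phi> 0 * x\<close> by \<open>x * (1 - x) * R x\<close> with a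
  polynomial \<open>R\<close>. The factor \<open>x * (1 - x) = (weight u)\<^sup>2\<close> turns
  uniform closeness of \<open>R\<close> to \<open>f\<close> into an error relative to
  \<open>weight\<close>.\<close>

theorem sums_by_admissible:
  assumes base: "sums_by (\<lambda>u. 1 / (1 + u)) l"
    and adm: "admissible \<phi>" and cont: "continuous_on {0..} \<phi>"
  shows "sums_by \<phi> l"
proof (rule sums_by_approx[OF adm])
  fix e :: real assume e: "e > 0"
  obtain C where C: "\<And>u. u \<ge> 0 \<Longrightarrow> \<bar>\<phi> u - \<phi> 0 / (1 + u)\<bar> \<le> C * (u / (1 + u)\<^sup>2)"
    using adm by (auto simp: admissible_def)
  have C0: "C \<ge> 0" using order_trans[OF abs_ge_zero C[of 1]] by simp
  \<comment> \<open>Chosen so that \<open>C * sqrt \<delta> \<le> e / 2\<close>; the summand 1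
    covers \<open>C = 0\<close>. The other half of \<open>e\<close> goes to the polynomial
    approximation.\<close>
  define \<delta> where "\<delta> = (e / (2 * (C + 1)))\<^sup>2"
  have \<delta>: "\<delta> > 0" using e C0 by (simp add: \<delta>_def)
  have sqrt\<delta>: "C * sqrt \<delta> \<le> e / 2"
    using e C0 by (simp add: \<delta>_def real_sqrt_divide field_simps)
  define D where "D = (\<lambda>x::real. \<phi> (1 / x - 1) - \<phi> 0 * x)"
  \<comment> \<open>\<open>D x / (x * (1 - x))\<close> need not extend continuously to the end points; the shift by \<open>\<delta>\<close>
    repairs this at a cost that AM-GM bounds by \<open>C * sqrt \<delta> * weight u\<close>.\<close>
  define f where "f = (\<lambda>x. if x = 0 then 0 else D x / (x * (1 - x) + \<delta>))"
  have D_bound: "\<bar>D x\<bar> \<le> C * (x * (1 - x))" if "0 < x" "x \<le> 1" for x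
  proof -
    define u where "u = 1 / x - 1"
    have "u \<ge> 0" and x: "x = 1 / (1 + u)" using that by (auto simp: u_def)
    then have "u / (1 + u)\<^sup>2 = x * (1 - x)"
      unfolding x by (simp add: power2_eq_square field_simps)
    moreover have "D x = \<phi> u - \<phi> 0 / (1 + u)" by (simp add: D_def u_def)
    ultimately show ?thesis using C[OF \<open>u \<ge> 0\<close>] by (simp only:)
  qed
  have f_bound: "\<bar>f x\<bar> \<le> C * (x * (1 - x)) / \<delta>" if "0 \<le> x" "x \<le> 1" for x
  proof (cases "x = 0")
    case False
    have "\<bar>f x\<bar> = \<bar>D x\<bar> / (x * (1 - x) + \<delta>)" using that \<delta> False by (simp add: f_def abs_divide)
    also have "\<dots> \<le> (C * (x * (1 - x))) / \<delta>"
      using that \<delta> False C0 by (intro frac_le D_bound) auto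
    finally show ?thesis .
  qed (simp add: f_def)
  have "continuous_on {0..1} f"
    unfolding continuous_on_eq_continuous_within
  proof
    fix x :: real assume x: "x \<in> {0..1}"
    show "continuous (at x within {0..1}) f"
    proof (cases "x = 0")
      \<comment> \<open>At 0 the argument \<open>1 / x - 1\<close> escapes to infinity, so
        continuity of \<open>\<phi>\<close> says nothing; the limit comes from
        \<open>f_bound\<close>.\<close>
      case True
      have "(f \<longlongrightarrow> 0) (at 0 within {0..1})"
      proof (rule Lim_null_comparison)
        show "eventually (\<lambda>x. norm (f x) \<le> C * (x * (1 - x)) / \<delta>) (at 0 within {0..1})"
          using f_bound by (auto simp: eventually_at_filter)
        have "((\<lambda>x. C * (x * (1 - x)) / \<delta>) \<longlongrightarrow> C * (0 * (1 - 0)) / \<delta>) (at 0 within {0..1})"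
          using \<delta> by (intro tendsto_intros) auto
        then show "((\<lambda>x. C * (x * (1 - x)) / \<delta>) \<longlongrightarrow> 0) (at 0 within {0..1})" by simp
      qed
      then show ?thesis by (simp add: continuous_within True f_def)
    next
      case False
      have pos: "y * (1 - y) + \<delta> > 0" if "y \<in> {0<..1}" for y
        using that \<delta> by (simp add: add_nonneg_pos)
      have "continuous_on {0<..1} (\<lambda>x. \<phi> (1 / x - 1))"
        by (rule continuous_on_compose2[OF cont]) (auto intro!: continuous_intros)
      then have "continuous_on {0<..1} (\<lambda>x. D x / (x * (1 - x) + \<delta>))"
        unfolding D_def using pos by (intro continuous_intros) force+
      then have "continuous_on {0<..1} f"
        by (rule continuous_on_eq) (auto simp: f_def)
      then have "continuous (at x within {0<..1}) f"
        using x False by (auto simp: continuous_on_eq_continuous_within)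
      moreover have "at x within {0<..1} = at x within {0..1}"
        using x False by (intro at_within_nhd[of _ "{0<..}"]) auto
      ultimately show ?thesis by (simp add: continuous_within)
    qed
  qed
  then obtain R where R: "real_polynomial_function R" "\<And>x. x \<in> {0..1} \<Longrightarrow> \<bar>f x - R x\<bar> < e / 2"
    using Stone_Weierstrass_real_polynomial_function[of "{0..1}" f "e / 2"] e by auto
  then obtain a n where a: "R = (\<lambda>x. \<Sum>i\<le>n. a i * x ^ i)"
    using real_polynomial_function_iff_sum by auto
  define P where "P = (\<lambda>b u. \<Sum>i\<le>n. b i * (1 / (1 + u) ^ Suc i) :: real)"
  \<comment> \<open>The shifted coefficients realise \<open>x * (x * R x)\<close>; together with
    \<open>P a u = x * R x\<close> this yields \<open>x * (1 - x) * R x\<close> in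
    \<open>\<psi>\<close>.\<close>
  define Q where "Q = (\<lambda>u. \<Sum>i\<le>Suc n. (if i = 0 then 0 else a (i - 1)) * (1 / (1 + u) ^ Suc i) :: real)"
  define \<psi> where "\<psi> = (\<lambda>u. \<phi> 0 * (1 / (1 + u) ^ 1) + (P a u + (- 1) * Q u))"
  have PQ: "admissible (P a)" "sums_by (P a) l" "admissible Q" "sums_by Q l"
    by (simp_all only: P_def Q_def sums_by_polynomial[OF base])
  have base': "admissible (\<lambda>u. 1 / (1 + u) ^ 1)" "sums_by (\<lambda>u. 1 / (1 + u) ^ 1) l"
    using base admissible_inverse_power[of 1 1] by auto
  have "admissible \<psi>" "sums_by \<psi> l"
    unfolding \<psi>_def by (intro sums_by_add sums_by_cmult admissible_add admissible_cmult PQ base')+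
  moreover have "\<bar>\<phi> u - \<psi> u\<bar> \<le> e * weight u" if u: "u \<ge> 0" for u
  proof -
    define x where "x = 1 / (1 + u)"
    define y where "y = x * (1 - x)"
    have x: "0 < x" "x \<le> 1" "1 / x - 1 = u" using u by (auto simp: x_def)
    have y: "y \<ge> 0" "y = (weight u)\<^sup>2"
      unfolding weight_power2[OF u] using x u
      by (auto simp: y_def x_def field_simps power2_eq_square)
    have P: "P a u = x * R x"
      by (simp add: P_def a x_def sum_distrib_left power_divide algebra_simps)
    have Q: "Q u = x * (x * R x)"
      unfolding Q_def by (subst sum.atMost_Suc_shift)
        (simp add: a x_def sum_distrib_left power_divide algebra_simps)
    have \<psi>: "\<psi> u = \<phi> 0 * x + y * R x"
      by (simp add: \<psi>_def P Q y_def algebra_simps) (simp add: x_def)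
    have "D x = \<phi> u - \<phi> 0 * x" using x by (simp add: D_def)
    moreover have "f x * (y + \<delta>) = D x"
      using x add_nonneg_pos[OF y(1) \<delta>] by (simp add: f_def y_def[symmetric])
    \<comment> \<open>The first summand is the cost of the shift by \<open>\<delta>\<close>, the
      second that of replacing \<open>f\<close> by \<open>R\<close>.\<close>
    ultimately have "\<phi> u - \<psi> u = f x * \<delta> + y * (f x - R x)"
      by (simp add: \<psi> algebra_simps)
    then have "\<bar>\<phi> u - \<psi> u\<bar> \<le> \<bar>f x\<bar> * \<delta> + y * \<bar>f x - R x\<bar>"
      using abs_triangle_ineq[of "f x * \<delta>" "y * (f x - R x)"] \<delta> y by (simp add: abs_mult)
    also have "y * \<bar>f x - R x\<bar> \<le> weight u * (e / 2)"
      using y u x R(2)[of x] weight_power2_le[OF u]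
      by (intro mult_mono) (auto simp: weight_power2 weight_nonneg)
    also have "\<bar>f x\<bar> * \<delta> \<le> C * sqrt \<delta> * weight u"
    proof -
      have "\<bar>f x\<bar> = \<bar>D x\<bar> / (y + \<delta>)" using x \<delta> y by (simp add: f_def y_def abs_divide)
      also have "\<dots> \<le> C * y / (y + \<delta>)"
        using x y \<delta> D_bound[of x] by (intro divide_right_mono) (auto simp: y_def)
      finally have "\<bar>f x\<bar> * \<delta> \<le> C * (y * \<delta> / (y + \<delta>))"
        using \<delta> mult_right_mono[of "\<bar>f x\<bar>" "C * y / (y + \<delta>)" \<delta>] by simp
      also have "y * \<delta> / (y + \<delta>) \<le> sqrt \<delta> * weight u"
      proof -
        have "2 * (sqrt \<delta> * weight u) \<le> y + \<delta>"
          using sum_squares_bound[of "sqrt \<delta>" "weight u"] \<delta> y(2) by simp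
        moreover have "0 \<le> sqrt \<delta> * weight u" using \<delta> weight_nonneg[OF u] by simp
        ultimately have "sqrt \<delta> * weight u \<le> y + \<delta>" by linarith
        then have "(sqrt \<delta> * weight u) * (sqrt \<delta> * weight u) \<le> (sqrt \<delta> * weight u) * (y + \<delta>)"
          using \<delta> weight_nonneg[OF u] by (intro mult_left_mono) auto
        moreover have "(sqrt \<delta> * weight u) * (sqrt \<delta> * weight u) = y * \<delta>"
          using \<delta> y by (simp add: power2_eq_square)
        ultimately show ?thesis using add_nonneg_pos[OF y(1) \<delta>] by (simp add: pos_divide_le_eq)
      qed
      finally show ?thesis using C0 by (simp add: mult_left_mono)
    qed
    also have "C * sqrt \<delta> * weight u \<le> e / 2 * weight u"
      using sqrt\<delta> weight_nonneg[OF u] by (intro mult_right_mono)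
    finally show ?thesis by simp
  qed
  ultimately show "\<exists>\<psi>. admissible \<psi> \<and> sums_by \<psi> l \<and> (\<forall>u\<ge>0. \<bar>\<phi> u - \<psi> u\<bar> \<le> e * weight u)"
    by blast
qed

section \<open>Averages over dilations\<close>

lemma transform_bounded:
  assumes adm: "admissible \<phi>" and sum: "sums_by \<phi> l"
  obtains B where "B \<ge> 0" "\<And>h. h > 0 \<Longrightarrow> norm (transform \<phi> h) \<le> B"
proof -
  obtain C where C: "C \<ge> 0" "\<And>u. u \<ge> 0 \<Longrightarrow> \<bar>\<phi> u\<bar> \<le> C / (1 + u)"
    using admissible_bound[OF adm] by blast
  let ?L = "complex_of_real (\<phi> 0) * l"
  have "eventually (\<lambda>h. dist (transform \<phi> h) ?L < 1) (at_right 0)"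
    using sum unfolding sums_by_def by (rule tendstoD) simp
  then obtain h0 where h0: "h0 > 0" "\<And>h. 0 < h \<Longrightarrow> h < h0 \<Longrightarrow> dist (transform \<phi> h) ?L < 1"
    by (auto simp: eventually_at_right_field)
  \<comment> \<open>Below \<open>h0\<close> the limit bounds the transform; from \<open>h0\<close>
    on, the majorant \<open>C / (1 + lam n * h)\<close> decreases in \<open>h\<close>, so its value
    at \<open>h0\<close> suffices.\<close>
  let ?S = "\<Sum>n. C * (norm (c n) / (1 + lam n * h0))"
  have S: "?S \<ge> 0"
    using C nonneg h0 by (intro suminf_nonneg summable_mult summable_decay) auto
  show ?thesis
  proof (rule that)
    show "0 \<le> norm ?L + 1 + ?S" using S by simp
    fix h :: real assume h: "h > 0"
    show "norm (transform \<phi> h) \<le> norm ?L + 1 + ?S"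
    proof (cases "h < h0")
      case True
      then have "norm (transform \<phi> h - ?L) < 1" using h0(2)[OF h] by (simp add: dist_norm)
      then show ?thesis using S norm_triangle_sub[of "transform \<phi> h" ?L] by linarith
    next
      case False
      have "norm (transform \<phi> h) \<le> ?S"
        unfolding transform_def
      proof (intro norm_suminf_le summable_mult summable_decay h0)
        fix n
        have "norm (c n * complex_of_real (\<phi> (lam n * h))) = norm (c n) * \<bar>\<phi> (lam n * h)\<bar>"
          by (simp add: norm_mult)
        also have "\<dots> \<le> norm (c n) * (C / (1 + lam n * h))"
          using h nonneg[of n] by (intro mult_left_mono C) auto
        also have "\<dots> \<le> norm (c n) * (C / (1 + lam n * h0))"
          using h h0 nonneg[of n] C False
          by (intro mult_left_mono divide_left_mono add_left_mono mult_pos_pos add_pos_nonneg) auto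
        finally show "norm (c n * complex_of_real (\<phi> (lam n * h))) \<le> C * (norm (c n) / (1 + lam n * h0))"
          by (simp add: algebra_simps)
      qed
      moreover have "norm ?L \<ge> 0" by simp
      ultimately show ?thesis by linarith
    qed
  qed
qed

text \<open>Exchanging sum and integral turns \<open>transform \<psi> h\<close> into the integral of
  \<open>k s * transform \<phi> (h * \<tau> s)\<close>; \<open>decay\<close> makes the exchange
  legitimate. The limit then follows by dominated convergence, with the bound on
  \<open>transform \<phi>\<close> times \<open>\<bar>k s\<bar>\<close> as majorant.\<close>

theorem sums_by_average:
  assumes adm: "admissible \<phi>" and sum: "sums_by \<phi> l"
    and k: "integrable lborel k"
    and pos: "\<And>s. k s \<noteq> 0 \<Longrightarrow> \<tau> s > 0"
    and \<psi>: "\<And>u. u \<ge> 0 \<Longrightarrow> has_bochner_integral lborel (\<lambda>s. k s * \<phi> (u * \<tau> s)) (\<psi> u)"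
    and decay: "\<And>u. u \<ge> 0 \<Longrightarrow> (LBINT s. \<bar>k s * \<phi> (u * \<tau> s)\<bar>) \<le> C / (1 + u)"
  shows "sums_by \<psi> l"
proof -
  obtain B where B: "B \<ge> 0" "\<And>h. h > 0 \<Longrightarrow> norm (transform \<phi> h) \<le> B"
    using transform_bounded[OF adm sum] by blast
  let ?g = "\<lambda>h s. complex_of_real (k s) * transform \<phi> (h * \<tau> s)"
  have swap: "integrable lborel (?g h) \<and> transform \<psi> h = (LBINT s. ?g h s)" if h: "h > 0" for h
  proof -
    let ?f = "\<lambda>n s. c n * complex_of_real (k s * \<phi> (lam n * h * \<tau> s))"
    have u: "lam n * h \<ge> 0" for n using nonneg[of n] h by simp
    have hf: "has_bochner_integral lborel (?f n) (c n * complex_of_real (\<psi> (lam n * h)))" for n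
      using \<psi>[OF u] by (intro has_bochner_integral_mult_right has_bochner_integral_of_real)
    have g: "(\<lambda>s. \<Sum>n. ?f n s) = ?g h" and ae: "summable (\<lambda>n. norm (?f n s))" for s
    proof -
      \<comment> \<open>Positivity of \<open>\<tau> s\<close> is known only where
        \<open>k s \<noteq> 0\<close>; elsewhere all terms are 0.\<close>
      have *: "summable (\<lambda>n. norm (?f n s)) \<and> (\<Sum>n. ?f n s) = ?g h s" for s
      proof (cases "k s = 0")
        case False
        then have hs: "h * \<tau> s > 0" using pos h by simp
        have e: "?f n s = complex_of_real (k s) * (c n * complex_of_real (\<phi> (lam n * (h * \<tau> s))))" for n
          by (simp add: mult.assoc mult.left_commute)
        show ?thesis unfolding e transform_def norm_mult[of "complex_of_real (k s)"]
          by (intro conjI summable_mult suminf_mult summable_norm_admissible[OF adm hs]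
              summable_admissible[OF adm hs])
      qed simp
      then show "(\<lambda>s. \<Sum>n. ?f n s) = ?g h" by auto
      show "summable (\<lambda>n. norm (?f n s))" using * by simp
    qed
    have sn: "summable (\<lambda>n. LBINT s. norm (?f n s))"
    proof (rule summable_comparison_test)
      show "summable (\<lambda>n. C * (norm (c n) / (1 + lam n * h)))"
        by (intro summable_mult summable_decay h)
      have "norm (LBINT s. norm (?f n s)) \<le> C * (norm (c n) / (1 + lam n * h))" for n
      proof -
        have "(LBINT s. norm (?f n s)) = norm (c n) * (LBINT s. \<bar>k s * \<phi> (lam n * h * \<tau> s)\<bar>)"
          by (simp add: norm_mult abs_mult)
        also have "\<dots> \<le> norm (c n) * (C / (1 + lam n * h))"
          by (intro mult_left_mono decay u) auto
        finally show ?thesis by (simp add: algebra_simps integral_nonneg_AE)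
      qed
      then show "\<exists>N. \<forall>n\<ge>N. norm (LBINT s. norm (?f n s)) \<le> C * (norm (c n) / (1 + lam n * h))"
        by blast
    qed
    have fi: "integrable lborel (?f n)" for n using hf by (rule integrable.intros)
    have "integrable lborel (?g h)"
      using integrable_suminf[OF fi _ sn] ae unfolding g by simp
    moreover have "transform \<psi> h = (LBINT s. ?g h s)"
    proof -
      have "transform \<psi> h = (\<Sum>n. LBINT s. ?f n s)"
        by (simp only: transform_def has_bochner_integral_integral_eq[OF hf])
      also have "\<dots> = (LBINT s. (\<Sum>n. ?f n s))"
        using ae by (intro integral_suminf[OF fi _ sn, symmetric]) auto
      finally show ?thesis by (simp only: g)
    qed
    ultimately show ?thesis by blast
  qed
  have \<psi>0: "\<psi> 0 = (LBINT s. k s) * \<phi> 0"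
    using has_bochner_integral_integral_eq[OF \<psi>[of 0]] by simp
  show ?thesis
    unfolding sums_by_def
  \<comment> \<open>Dominated convergence is applied along sequences, so the one-sided limit is
    tested on positive null sequences.\<close>
  proof (rule tendsto_at_right_sequentially[of 0 1])
    fix S :: "nat \<Rightarrow> real" assume S: "\<And>n. 0 < S n" "S \<longlonglongrightarrow> 0"
    have "(\<lambda>i. LBINT s. ?g (S i) s) \<longlonglongrightarrow> (LBINT s. complex_of_real (k s) * (complex_of_real (\<phi> 0) * l))"
    proof (rule integral_dominated_convergence[where w = "\<lambda>s. B * \<bar>k s\<bar>"])
      show "(\<lambda>s. complex_of_real (k s) * (complex_of_real (\<phi> 0) * l)) \<in> borel_measurable lborel"
        using k by measurable
      show "?g (S i) \<in> borel_measurable lborel" for i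
        by (rule borel_measurable_integrable[OF conjunct1[OF swap[OF S(1)]]])
      show "integrable lborel (\<lambda>s. B * \<bar>k s\<bar>)" using k by simp
      show "AE s in lborel. (\<lambda>i. ?g (S i) s) \<longlonglongrightarrow> complex_of_real (k s) * (complex_of_real (\<phi> 0) * l)"
      proof (intro AE_I2)
        fix s
        show "(\<lambda>i. ?g (S i) s) \<longlonglongrightarrow> complex_of_real (k s) * (complex_of_real (\<phi> 0) * l)"
        proof (cases "k s = 0")
          case False
          then have p: "\<tau> s > 0" by (rule pos)
          have "S i \<noteq> 0" for i using S(1)[of i] by simp
          then have "filterlim (\<lambda>i. S i * \<tau> s) (at_right 0) sequentially"
            unfolding filterlim_at using S p tendsto_mult[OF S(2) tendsto_const[of "\<tau> s"]] by auto
          with sum have "(\<lambda>i. transform \<phi> (S i * \<tau> s)) \<longlonglongrightarrow> complex_of_real (\<phi> 0) * l"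
            unfolding sums_by_def by (rule filterlim_compose)
          then show ?thesis by (intro tendsto_mult tendsto_const)
        qed simp
      qed
      show "AE s in lborel. norm (?g (S i) s) \<le> B * \<bar>k s\<bar>" for i
      proof (intro AE_I2)
        fix s
        show "norm (?g (S i) s) \<le> B * \<bar>k s\<bar>"
        proof (cases "k s = 0")
          case False
          then have "S i * \<tau> s > 0" using pos S by simp
          then show ?thesis
            using mult_left_mono[OF B(2), of "S i * \<tau> s" "\<bar>k s\<bar>"] by (simp add: norm_mult mult.commute)
        qed simp
      qed
    qed
    moreover have "(\<lambda>i. LBINT s. ?g (S i) s) = (\<lambda>i. transform \<psi> (S i))"
      using swap S(1) by auto
    moreover have "(LBINT s. complex_of_real (k s) * (complex_of_real (\<phi> 0) * l)) = complex_of_real (\<psi> 0) * l"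
      by (simp add: \<psi>0 mult.assoc)
    ultimately show "(\<lambda>i. transform \<psi> (S i)) \<longlonglongrightarrow> complex_of_real (\<psi> 0) * l"
      by (simp only:)
  qed simp
qed

subsection \<open>Comparison of the methods\<close>

lemma sums_by_base_if_exp:
  assumes "sums_by (\<lambda>u. exp (- u)) l"
  shows "sums_by (\<lambda>u. 1 / (1 + u)) l"
proof (rule sums_by_average[OF admissible_exp assms])
  let ?k = "\<lambda>s::real. indicator {0<..} s * exp (- s) :: real"
  show "integrable lborel ?k"
    using has_bochner_integral_exp_Ioi[of 0] by (simp add: has_bochner_integral_iff)
  show "0 < s" if "?k s \<noteq> 0" for s using that by (auto simp: indicator_def split: if_splits)
  fix u :: real assume u: "u \<ge> 0"
  show "has_bochner_integral lborel (\<lambda>s. ?k s * exp (- (u * s))) (1 / (1 + u))"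
    by (rule has_bochner_integral_exp_Ioi[OF u])
  from has_bochner_integral_integral_eq[OF this]
  show "(LBINT s. \<bar>?k s * exp (- (u * s))\<bar>) \<le> 1 / (1 + u)" by (simp add: abs_mult)
qed

lemma sums_by_exp_if_riesz:
  assumes \<beta>: "\<beta> > 0" and "sums_by (riesz_kernel \<beta>) l"
  shows "sums_by (\<lambda>u. exp (- u)) l"
proof (rule sums_by_average[OF admissible_riesz_kernel[OF \<beta>] assms(2)])
  let ?k = "\<lambda>s::real. indicator {0<..} s * s powr \<beta> * exp (- s) / Gamma (\<beta> + 1) :: real"
  have G: "Gamma (\<beta> + 1) > 0" using \<beta> by (intro Gamma_real_pos) simp
  show "integrable lborel ?k"
    using integrable.intros[OF has_bochner_integral_riesz_kernel[OF \<beta>, of 0]]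
    by (simp add: riesz_kernel_def)
  show "0 < 1 / s" if "?k s \<noteq> 0" for s using that by (auto simp: indicator_def split: if_splits)
  fix u :: real assume u: "u \<ge> 0"
  show "has_bochner_integral lborel (\<lambda>s. ?k s * riesz_kernel \<beta> (u * (1 / s))) (exp (- u))"
    by (rule has_bochner_integral_riesz_kernel[OF \<beta> u])
  from has_bochner_integral_integral_eq[OF this]
  have "(LBINT s. \<bar>?k s * riesz_kernel \<beta> (u * (1 / s))\<bar>) = exp (- u)"
    using G by (simp add: abs_mult riesz_kernel_def)
  also have "\<dots> \<le> 1 / (1 + u)"
    using u exp_ge_add_one_self[of u] by (simp add: exp_minus field_simps)
  finally show "(LBINT s. \<bar>?k s * riesz_kernel \<beta> (u * (1 / s))\<bar>) \<le> 1 / (1 + u)" .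
qed

text \<open>The Young function may change sign, so the absolute integral has to be estimated apart
  from the integral itself. The decay \<open>B / (1 + u * s)\<close> is at most
  \<open>B * (1 + 1 / s) / (1 + u)\<close>, and \<open>1 / s\<close> lowers the power in
  \<open>?k\<close> to that in \<open>?k'\<close>, which is still integrable.\<close>

lemma sums_by_inverse_square_if_young:
  assumes \<kappa>: "\<kappa> \<ge> 1" and "sums_by (young_fun \<kappa>) l"
  shows "sums_by (\<lambda>u. 1 / (1 + u\<^sup>2)) l"
proof -
  let ?k = "\<lambda>s::real. indicator {0<..} s * s powr \<kappa> * exp (- s) / Gamma (\<kappa> + 1) :: real"
  let ?k' = "\<lambda>s::real. indicator {0<..} s * s powr (\<kappa> - 1) * exp (- s) / Gamma (\<kappa> + 1) :: real"
  have G: "Gamma (\<kappa> + 1) > 0" using \<kappa> by (intro Gamma_real_pos) simp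
  have k: "integrable lborel ?k"
    using integrable.intros[OF has_bochner_integral_young_fun[OF \<kappa>, of 0]] by simp
  have k': "integrable lborel ?k'"
    using has_bochner_integral_Gamma_shift[of \<kappa> 0] \<kappa>
    by (intro integrable_divide_zero) (auto simp: has_bochner_integral_iff)
  obtain B where B: "B \<ge> 0" "\<And>u. u \<ge> 0 \<Longrightarrow> \<bar>young_fun \<kappa> u\<bar> \<le> B / (1 + u)"
    using admissible_bound[OF admissible_young_fun[OF \<kappa>]] by blast
  show ?thesis
  proof (rule sums_by_average[OF admissible_young_fun[OF \<kappa>] assms(2) k])
    show "0 < s" if "?k s \<noteq> 0" for s using that by (auto simp: indicator_def split: if_splits)
    fix u :: real assume u: "u \<ge> 0"
    show y: "has_bochner_integral lborel (\<lambda>s. ?k s * young_fun \<kappa> (u * s)) (1 / (1 + u\<^sup>2))"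
      by (rule has_bochner_integral_young_fun[OF \<kappa> u])
    have "(LBINT s. \<bar>?k s * young_fun \<kappa> (u * s)\<bar>) \<le> (LBINT s. B / (1 + u) * (?k s + ?k' s))"
    proof (rule integral_mono)
      show "integrable lborel (\<lambda>s. \<bar>?k s * young_fun \<kappa> (u * s)\<bar>)"
        using y by (simp only: has_bochner_integral_iff integrable_abs)
      show "integrable lborel (\<lambda>s. B / (1 + u) * (?k s + ?k' s))"
        by (intro integrable_mult_right Bochner_Integration.integrable_add k k')
      fix s :: real
      show "\<bar>?k s * young_fun \<kappa> (u * s)\<bar> \<le> B / (1 + u) * (?k s + ?k' s)"
      proof (cases "s > 0")
        case True
        have "\<bar>young_fun \<kappa> (u * s)\<bar> \<le> B / (1 + u * s)" using u True by (intro B) auto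
        also have "\<dots> \<le> B * (1 + 1 / s) / (1 + u)"
        proof -
          have "1 + u \<le> (1 + 1 / s) * (1 + u * s)" using u True by (simp add: field_simps)
          from mult_left_mono[OF this B(1)] show ?thesis
            using u True add_pos_nonneg[of 1 "u * s"] by (simp add: divide_simps mult_ac)
        qed
        finally have "?k s * \<bar>young_fun \<kappa> (u * s)\<bar> \<le> ?k s * (B * (1 + 1 / s) / (1 + u))"
          using G by (intro mult_left_mono) auto
        also have "x * (B * (1 + 1 / s) / (1 + u)) = B / (1 + u) * (x + x / s)" for x
          using u True by (simp add: field_simps)
        also have "?k s / s = ?k' s" using True by (simp add: powr_diff)
        finally show ?thesis using G by (simp add: abs_mult)
      qed simp
    qed
    also have "\<dots> = B / (1 + u) * (LBINT s. ?k s + ?k' s)" by (rule integral_mult_right_zero)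
    finally show "(LBINT s. \<bar>?k s * young_fun \<kappa> (u * s)\<bar>) \<le> B * (LBINT s. ?k s + ?k' s) / (1 + u)"
      by simp
  qed
qed

lemma sums_by_base_if_inverse_square:
  assumes "sums_by (\<lambda>u. 1 / (1 + u\<^sup>2)) l"
  shows "sums_by (\<lambda>u. 1 / (1 + u)) l"
proof (rule sums_by_average[OF admissible_inverse_square assms])
  let ?k = "\<lambda>s::real. indicator {0<..} s * (2 / pi / (1 + s\<^sup>2)) :: real"
  show "integrable lborel ?k"
    using has_bochner_integral_inverse_square[of 0] by (simp add: has_bochner_integral_iff)
  show "0 < s" if "?k s \<noteq> 0" for s using that by (auto simp: indicator_def split: if_splits)
  fix u :: real assume u: "u \<ge> 0"
  show "has_bochner_integral lborel (\<lambda>s. ?k s * (1 / (1 + (u * s)\<^sup>2))) (1 / (1 + u))"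
    by (rule has_bochner_integral_inverse_square[OF u])
  from has_bochner_integral_integral_eq[OF this]
  show "(LBINT s. \<bar>?k s * (1 / (1 + (u * s)\<^sup>2))\<bar>) \<le> 1 / (1 + u)" by (simp add: abs_mult)
qed

section \<open>The summability methods expressed through kernels\<close>

lemma abel_summable_iff: "abel_summable lam c l \<longleftrightarrow> sums_by (\<lambda>u. exp (- u)) l"
  using summable_admissible[OF admissible_exp]
  by (simp add: abel_summable_def sums_by_def transform_def[abs_def])

text \<open>Admissibility gives convergence for every \<open>h > 0\<close>, so any threshold
  \<open>h0\<close> serves and the limit is what remains.\<close>

lemma young_summable_iff:
  assumes "\<kappa> \<ge> 1"
  shows "young_summable lam \<kappa> c l \<longleftrightarrow> sums_by (young_fun \<kappa>) l"
  using summable_admissible[OF admissible_young_fun[OF assms]]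
  by (auto simp: young_summable_def sums_by_def transform_def[abs_def] intro!: exI[of _ 1])

lemma riesz_summable_iff:
  assumes "\<beta> > 0"
  shows "riesz_summable lam \<beta> c l \<longleftrightarrow> sums_by (riesz_kernel \<beta>) l"
proof -
  have "eventually (\<lambda>x. (\<Sum>n\<in>{n. lam n \<le> x}. c n * complex_of_real ((1 - lam n / x) powr \<beta>))
      = transform (riesz_kernel \<beta>) (inverse x)) at_top"
    using eventually_gt_at_top[of 0]
  proof eventually_elim
    case (elim x)
    have "transform (riesz_kernel \<beta>) (inverse x)
        = (\<Sum>n\<in>{n. lam n \<le> x}. c n * complex_of_real (riesz_kernel \<beta> (lam n * inverse x)))"
      unfolding transform_def
    proof (rule suminf_finite[OF finite_level])
      fix n assume "n \<notin> {n. lam n \<le> x}"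
      then have "1 - lam n * inverse x \<le> 0" using elim by (simp add: field_simps)
      then show "c n * complex_of_real (riesz_kernel \<beta> (lam n * inverse x)) = 0"
        by (simp add: riesz_kernel_def max_def)
    qed
    also have "\<dots> = (\<Sum>n\<in>{n. lam n \<le> x}. c n * complex_of_real ((1 - lam n / x) powr \<beta>))"
      using elim by (intro sum.cong) (auto simp: riesz_kernel_def max_def field_simps)
    finally show ?case by simp
  qed
  then have "riesz_summable lam \<beta> c l \<longleftrightarrow> ((\<lambda>x. transform (riesz_kernel \<beta>) (inverse x)) \<longlongrightarrow> l) at_top"
    unfolding riesz_summable_def by (rule tendsto_cong)
  then show ?thesis
    by (simp add: sums_by_def filterlim_at_right_to_top riesz_kernel_def)
qed

text \<open>The exponential has modulus 1, so the additional series is dominated in its tail by a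
  multiple of \<open>norm (c n) / (1 + lam n)\<close>, which converges by
  \<open>summable_decay\<close>; this works for every \<open>h \<noteq> 0\<close>.\<close>

lemma L_summable_iff: "L_summable lam c l \<longleftrightarrow> young_summable lam 1 c l"
proof -
  have "summable (\<lambda>n. if lam n > 0
      then c n * exp (\<i> * complex_of_real (lam n * h)) / complex_of_real (lam n * h) else 0)"
    if "0 < \<bar>h\<bar>" for h
  proof (rule summable_comparison_test_ev)
    show "summable (\<lambda>n. 2 / \<bar>h\<bar> * (norm (c n) / (1 + lam n * 1)))"
      by (intro summable_mult summable_decay) simp
    show "eventually (\<lambda>n. norm (if lam n > 0
      then c n * exp (\<i> * complex_of_real (lam n * h)) / complex_of_real (lam n * h) else 0)
      \<le> 2 / \<bar>h\<bar> * (norm (c n) / (1 + lam n * 1))) sequentially"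
      using eventually_lam_ge[of 1]
    proof eventually_elim
      case (elim n)
      have "norm (exp (\<i> * complex_of_real (lam n * h))) = 1" by (rule norm_exp_i_times)
      then have "norm (c n * exp (\<i> * complex_of_real (lam n * h)) / complex_of_real (lam n * h))
          = norm (c n) / \<bar>h\<bar> * (1 / lam n)"
        using elim by (simp only: norm_mult norm_divide norm_of_real abs_mult) simp
      also have "\<dots> \<le> norm (c n) / \<bar>h\<bar> * (2 / (1 + lam n))"
        using elim by (intro mult_left_mono) (auto simp: field_simps)
      finally show ?case using elim by (simp add: mult_ac)
    qed
  qed
  then show ?thesis by (auto simp: L_summable_def intro!: exI[of _ 1])
qed

lemma sums_by_exp_iff_base:
  "sums_by (\<lambda>u. exp (- u)) l \<longleftrightarrow> sums_by (\<lambda>u. 1 / (1 + u)) l"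
  by (auto intro!: sums_by_base_if_exp sums_by_admissible[OF _ admissible_exp] continuous_intros)

lemma sums_by_young_iff_base:
  "\<kappa> \<ge> 1 \<Longrightarrow> sums_by (young_fun \<kappa>) l \<longleftrightarrow> sums_by (\<lambda>u. 1 / (1 + u)) l"
  using sums_by_base_if_inverse_square[OF sums_by_inverse_square_if_young]
    sums_by_admissible[OF _ admissible_young_fun continuous_young_fun] by blast

lemma sums_by_riesz_iff_base:
  "\<beta> > 0 \<Longrightarrow> sums_by (riesz_kernel \<beta>) l \<longleftrightarrow> sums_by (\<lambda>u. 1 / (1 + u)) l"
  using sums_by_base_if_exp[OF sums_by_exp_if_riesz]
    sums_by_admissible[OF _ admissible_riesz_kernel continuous_riesz_kernel] by blast

end

theorem theorem3p1:
  fixes lam :: "nat \<Rightarrow> real" and c :: "nat \<Rightarrow> complex" and l :: complex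
  assumes mono: "mono lam"
    and nonneg: "\<And>n. lam n \<ge> 0"
    and infty: "filterlim lam at_top sequentially"
    and bound: "(\<lambda>x. \<Sum>n\<in>{n. lam n \<le> x}. lam n * norm (c n)) \<in> O[at_top](\<lambda>x. x)"
  shows "(L_summable lam c l \<longleftrightarrow> abel_summable lam c l)
       \<and> ((\<exists>\<kappa>\<ge>1. young_summable lam \<kappa> c l) \<longleftrightarrow> abel_summable lam c l)
       \<and> ((\<forall>\<kappa>\<ge>1. young_summable lam \<kappa> c l) \<longleftrightarrow> abel_summable lam c l)
       \<and> ((\<exists>\<beta>>0. riesz_summable lam \<beta> c l) \<longleftrightarrow> abel_summable lam c l)
       \<and> ((\<forall>\<beta>>0. riesz_summable lam \<beta> c l) \<longleftrightarrow> abel_summable lam c l)"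
proof -
  interpret slow_series lam c
    by (unfold_locales) (fact nonneg infty bound)+
  have young: "young_summable lam \<kappa> c l \<longleftrightarrow> abel_summable lam c l" if "\<kappa> \<ge> 1" for \<kappa>
    using that by (simp add: young_summable_iff abel_summable_iff sums_by_young_iff_base sums_by_exp_iff_base)
  have riesz: "riesz_summable lam \<beta> c l \<longleftrightarrow> abel_summable lam c l" if "\<beta> > 0" for \<beta>
    using that by (simp add: riesz_summable_iff abel_summable_iff sums_by_riesz_iff_base sums_by_exp_iff_base)
  \<comment> \<open>Each parameter value separately is equivalent to the Abel method, which settles
    the forms with "for all"; for those with "for some", 1 is an available parameter.\<close>
  show ?thesis
    using young riesz L_summable_iff[of l] zero_less_one order_refl by blast
qed

end
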